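(* Let $\mathcal M$ be a (two-dimensional) surface embedded in $\mathbb R^n$, with a Poisson structure $\{\cdot,\cdot\}$, and let $(p,q)$ be conjugate coordinates with $\{p,q\}=1$ on a patch $U\subset\mathcal M$. Let $x_1,\dots,x_n:U\to\mathbb R$ be the restrictions of the coordinates of $\mathbb R^n$, and let $g$ be the metric on $\mathcal M$ obtained by pulling back the Euclidean metric of $\mathbb R^n$. Then the metric can be given solely in terms of the Poisson structure and the functions $x_i,p,q:U\to\mathbb R$: for functions $u,v$ on $U$, $$g(du^\sharp,dv^\sharp)=\frac1C\sum_i\{x_i,u\}\{x_i,v\},$$ where $C:U\to\mathbb R$ is given by $$C=\sum_{i,j}\{p,x_i\}\{q,x_j\}\{x_i,x_j\}.$$
   Context: $\sharp:T^\star\mathcal M\to T\mathcal M$ is the metric dual, defined by $\xi(X)=g(\xi^\sharp,X)$ for every tangent vector $X$. In the conjugate coordinates, $\{u,v\}=\frac{\partial u}{\partial p}\frac{\partial v}{\partial q}-\frac{\partial u}{\partial q}\frac{\partial v}{\partial p}$. *)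

theory Defs
  imports "HOL-Analysis.Analysis"
begin

text \<open>Smoothness is \<open>C\<^sup>\<infinity>\<close> throughout. The first two notions are meant for open sets \<open>S\<close>: the
  iterated derivatives are the directional derivatives along constant vectors.\<close>

primrec Ck_on :: "nat \<Rightarrow> 'a::real_normed_vector set \<Rightarrow> ('a \<Rightarrow> 'b::real_normed_vector) \<Rightarrow> bool" where
  "Ck_on 0 S f \<longleftrightarrow> continuous_on S f"
| "Ck_on (Suc k) S f \<longleftrightarrow>
     (\<forall>x\<in>S. f differentiable (at x)) \<and>
     (\<forall>v. Ck_on k S (\<lambda>x. frechet_derivative f (at x) v))"

definition smooth_on :: "'a::real_normed_vector set \<Rightarrow> ('a \<Rightarrow> 'b::real_normed_vector) \<Rightarrow> bool" where
  "smooth_on S f \<longleftrightarrow> (\<forall>k. Ck_on k S f)"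

text \<open>Functions on a (relatively open subset of a) submanifold \<open>A\<close> are represented by total functions
  on the ambient space, whose values outside \<open>A\<close> are irrelevant. Smooth means: locally the restriction
  of a smooth function on an open subset of the ambient space.\<close>

definition smooth_fun :: "'a::real_normed_vector set \<Rightarrow> ('a \<Rightarrow> real) \<Rightarrow> bool" where
  "smooth_fun A f \<longleftrightarrow>
     (\<forall>x\<in>A. \<exists>V F. open V \<and> x \<in> V \<and> smooth_on V F \<and> (\<forall>y\<in>A \<inter> V. f y = F y))"

definition embedded_surface :: "'a::euclidean_space set \<Rightarrow> bool" where
  "embedded_surface M \<longleftrightarrow>
     (\<forall>x\<in>M. \<exists>U (W :: (real \<times> real) set) \<phi> \<psi>.
        x \<in> U \<and> openin (top_of_set M) U \<and> open W \<and>
        homeomorphism W U \<phi> \<psi> \<and> smooth_on W \<phi> \<and>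
        (\<forall>w\<in>W. inj (frechet_derivative \<phi> (at w))))"

text \<open>Tangent vectors are the velocities of smooth curves in \<open>M\<close>; the differential of \<open>u\<close> sends the
  velocity of such a curve to the derivative of \<open>u\<close> along it.\<close>

definition curve_at :: "'a::euclidean_space set \<Rightarrow> 'a \<Rightarrow> (real \<Rightarrow> 'a) \<Rightarrow> bool" where
  "curve_at M x \<gamma> \<longleftrightarrow>
     (\<exists>e>0. smooth_on {-e<..<e} \<gamma> \<and> \<gamma> ` {-e<..<e} \<subseteq> M \<and> \<gamma> 0 = x)"

definition tangent_space :: "'a::euclidean_space set \<Rightarrow> 'a \<Rightarrow> 'a set" where
  "tangent_space M x = {vector_derivative \<gamma> (at 0) | \<gamma>. curve_at M x \<gamma>}"

definition differential ::
    "'a::euclidean_space set \<Rightarrow> ('a \<Rightarrow> real) \<Rightarrow> 'a \<Rightarrow> 'a \<Rightarrow> real" where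
  "differential M u x X =
     (THE d. \<exists>\<gamma>. curve_at M x \<gamma> \<and> vector_derivative \<gamma> (at 0) = X \<and>
                 ((\<lambda>t. u (\<gamma> t)) has_real_derivative d) (at 0))"

text \<open>The pullback of the Euclidean metric along the inclusion. The point is an explicit argument, and
  only arguments tangent to the surface at that point are meaningful.\<close>

definition induced_metric :: "'a::euclidean_space \<Rightarrow> 'a \<Rightarrow> 'a \<Rightarrow> real" where
  "induced_metric x X Y = X \<bullet> Y"

definition sharp ::
    "'a::euclidean_space set \<Rightarrow> ('a \<Rightarrow> 'a \<Rightarrow> 'a \<Rightarrow> real) \<Rightarrow> 'a \<Rightarrow> ('a \<Rightarrow> real) \<Rightarrow> 'a" where
  "sharp M g x \<xi> =
     (THE Y. Y \<in> tangent_space M x \<and> (\<forall>X\<in>tangent_space M x. \<xi> X = g x Y X))"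

text \<open>A Poisson structure is a Lie bracket on \<open>C\<^sup>\<infinity>(M)\<close> that is a derivation in each argument. The second
  clause says that the bracket only depends on the restrictions of the functions to \<open>M\<close>.\<close>

definition poisson_structure ::
    "'a::real_normed_vector set \<Rightarrow> (('a \<Rightarrow> real) \<Rightarrow> ('a \<Rightarrow> real) \<Rightarrow> 'a \<Rightarrow> real) \<Rightarrow> bool" where
  "poisson_structure M br \<longleftrightarrow>
     (\<forall>u v. smooth_fun M u \<longrightarrow> smooth_fun M v \<longrightarrow> smooth_fun M (br u v)) \<and>
     (\<forall>u u' v v'. smooth_fun M u \<longrightarrow> smooth_fun M u' \<longrightarrow> smooth_fun M v \<longrightarrow> smooth_fun M v' \<longrightarrow>
        (\<forall>x\<in>M. u x = u' x) \<longrightarrow> (\<forall>x\<in>M. v x = v' x) \<longrightarrow> (\<forall>x\<in>M. br u v x = br u' v' x)) \<and>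
     (\<forall>a b u v w. smooth_fun M u \<longrightarrow> smooth_fun M v \<longrightarrow> smooth_fun M w \<longrightarrow>
        (\<forall>x\<in>M. br (\<lambda>y. a * u y + b * v y) w x = a * br u w x + b * br v w x)) \<and>
     (\<forall>u v. smooth_fun M u \<longrightarrow> smooth_fun M v \<longrightarrow> (\<forall>x\<in>M. br u v x = - br v u x)) \<and>
     (\<forall>u v w. smooth_fun M u \<longrightarrow> smooth_fun M v \<longrightarrow> smooth_fun M w \<longrightarrow>
        (\<forall>x\<in>M. br (\<lambda>y. u y * v y) w x = u x * br v w x + br u w x * v x)) \<and>
     (\<forall>u v w. smooth_fun M u \<longrightarrow> smooth_fun M v \<longrightarrow> smooth_fun M w \<longrightarrow>
        (\<forall>x\<in>M. br u (br v w) x + br v (br w u) x + br w (br u v) x = 0))"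

text \<open>A Poisson bracket is a local operation, so it acts on functions that are only defined on an open
  patch: evaluate at \<open>x\<close> the bracket of any globally smooth functions with the same germs at \<open>x\<close>.\<close>

definition same_germ :: "'a::topological_space set \<Rightarrow> 'a \<Rightarrow> ('a \<Rightarrow> real) \<Rightarrow> ('a \<Rightarrow> real) \<Rightarrow> bool" where
  "same_germ M x u v \<longleftrightarrow> (\<exists>V. openin (top_of_set M) V \<and> x \<in> V \<and> (\<forall>y\<in>V. u y = v y))"

definition local_bracket ::
    "'a::real_normed_vector set \<Rightarrow> (('a \<Rightarrow> real) \<Rightarrow> ('a \<Rightarrow> real) \<Rightarrow> 'a \<Rightarrow> real) \<Rightarrow>
     ('a \<Rightarrow> real) \<Rightarrow> ('a \<Rightarrow> real) \<Rightarrow> 'a \<Rightarrow> real" where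
  "local_bracket M br u v x =
     (THE c. \<exists>a b. smooth_fun M a \<and> smooth_fun M b \<and>
                   same_germ M x a u \<and> same_germ M x b v \<and> c = br a b x)"

definition local_coordinates ::
    "'a::euclidean_space set \<Rightarrow> 'a set \<Rightarrow> ('a \<Rightarrow> real) \<Rightarrow> ('a \<Rightarrow> real) \<Rightarrow> bool" where
  "local_coordinates M U p q \<longleftrightarrow>
     openin (top_of_set M) U \<and> smooth_fun U p \<and> smooth_fun U q \<and>
     inj_on (\<lambda>x. (p x, q x)) U \<and> open ((\<lambda>x. (p x, q x)) ` U) \<and>
     smooth_on ((\<lambda>x. (p x, q x)) ` U) (the_inv_into U (\<lambda>x. (p x, q x)))"

definition conjugate_coordinates ::
    "'a::euclidean_space set \<Rightarrow> (('a \<Rightarrow> real) \<Rightarrow> ('a \<Rightarrow> real) \<Rightarrow> 'a \<Rightarrow> real) \<Rightarrow>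
     'a set \<Rightarrow> ('a \<Rightarrow> real) \<Rightarrow> ('a \<Rightarrow> real) \<Rightarrow> bool" where
  "conjugate_coordinates M br U p q \<longleftrightarrow>
     local_coordinates M U p q \<and> (\<forall>x\<in>U. local_bracket M br p q x = 1)"

end

theory Submission
  imports Defs
begin

text \<open>At a point \<open>x\<close> of the patch, Hadamard's lemma shows that the bracket of two functions depends only on
  the derivatives of local extensions to the ambient space. Extending \<open>u\<close> near \<open>x\<close> as a function of
  extensions of \<open>p\<close> and \<open>q\<close> then yields \<open>{u, v} = u\<^sub>p v\<^sub>q - u\<^sub>q v\<^sub>p\<close>. The tangent plane is spanned by the
  partial derivatives \<open>e\<close>, \<open>f\<close> of the inverse chart, and \<open>{x\<^sub>i, u} = e\<^sub>i u\<^sub>q - f\<^sub>i u\<^sub>p\<close>. Hence \<open>C\<close> is the Gram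
  determinant of \<open>e\<close> and \<open>f\<close>, and the claim is Cramer's rule for the inverse of the Gram matrix.\<close>

subsection \<open>Calculus of \<open>C\<^sup>k\<close> functions\<close>

text \<open>The bracket is given only for functions smooth on all of \<open>M\<close>, while
  \<open>p\<close>, \<open>q\<close>, \<open>u\<close>, \<open>v\<close> live on \<open>U\<close>.
  Bump functions bridge this gap: they turn a local ambient extension into a globally smooth
  function with the same germ. The second obstacle is that an ambient extension is prescribed only
  along \<open>M\<close>, so its derivative at \<open>x\<close> is not determined in normal
  directions. The bracket formula in terms of ambient derivatives nevertheless holds for every
  extension, and this freedom allows a given extension to be traded for one that factors through
  \<open>p\<close> and \<open>q\<close>, so that no normal direction has to be discussed. Division
  by \<open>C\<close> is legitimate because the inverse chart has the smooth left inverse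
  \<open>(p, q)\<close>, which makes \<open>e\<close> and \<open>f\<close> linearly
  independent.\<close>

lemma Ck_on_cong:
  assumes "open S" "\<And>x. x \<in> S \<Longrightarrow> f x = g x" "Ck_on k S f"
  shows "Ck_on k S g"
  using assms(2,3)
proof (induction k arbitrary: f g)
  case 0
  then show ?case using continuous_on_cong by force
next
  case (Suc k)
  have *: "(g has_derivative frechet_derivative f (at x)) (at x)" if "x \<in> S" for x
    using Suc.prems that assms(1) frechet_derivative_works
    by (metis Ck_on.simps(2) has_derivative_transform_within_open)
  have "Ck_on k S (\<lambda>x. frechet_derivative g (at x) v)" for v
  proof (rule Suc.IH)
    show "Ck_on k S (\<lambda>x. frechet_derivative f (at x) v)" using Suc.prems by simp
    show "frechet_derivative f (at x) v = frechet_derivative g (at x) v" if "x \<in> S" for x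
      using frechet_derivative_at[OF *[OF that]] by simp
  qed
  then show ?case using * by (auto simp: differentiable_def)
qed

text \<open>On an open set the derivative is unique, so an explicit formula can replace the
  choice-based \<open>frechet_derivative\<close> in smoothness proofs.\<close>

lemma Ck_on_SucI:
  assumes "open S" "\<And>x. x \<in> S \<Longrightarrow> (f has_derivative f' x) (at x)"
    and "\<And>v. Ck_on k S (\<lambda>x. f' x v)"
  shows "Ck_on (Suc k) S f"
proof -
  have "Ck_on k S (\<lambda>x. frechet_derivative f (at x) v)" for v
    by (rule Ck_on_cong[OF assms(1) _ assms(3)[of v]])
      (simp add: frechet_derivative_at[OF assms(2)])
  then show ?thesis using assms(2) by (auto simp: differentiable_def)
qed

lemma Ck_on_SucD:
  assumes "Ck_on (Suc k) S f"
  shows "x \<in> S \<Longrightarrow> (f has_derivative frechet_derivative f (at x)) (at x)"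
    and "Ck_on k S (\<lambda>x. frechet_derivative f (at x) v)"
  using assms frechet_derivative_works by auto

lemma Ck_on_imp_continuous_on: "Ck_on k S f \<Longrightarrow> continuous_on S f"
  by (cases k) (auto intro: continuous_at_imp_continuous_on differentiable_imp_continuous_within)

lemma Ck_on_Suc_imp: "Ck_on (Suc k) S f \<Longrightarrow> Ck_on k S f"
proof (induction k arbitrary: f)
  case 0
  show ?case using Ck_on_imp_continuous_on[OF 0] by simp
next
  case (Suc k)
  then show ?case by (metis Ck_on.simps(2))
qed

lemma Ck_on_subset: "Ck_on k S f \<Longrightarrow> T \<subseteq> S \<Longrightarrow> Ck_on k T f"
  by (induction k arbitrary: f) (auto intro: continuous_on_subset)

lemma Ck_on_Un:
  "open S \<Longrightarrow> open T \<Longrightarrow> Ck_on k S f \<Longrightarrow> Ck_on k T f \<Longrightarrow> Ck_on k (S \<union> T) f"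
  by (induction k arbitrary: f) (auto intro: continuous_on_open_Un)

lemma Ck_on_const: "Ck_on k S (\<lambda>x. c)"
  by (induction k arbitrary: c) auto

lemma Ck_on_linear_compose:
  assumes "open S" "bounded_linear L" "Ck_on k S f"
  shows "Ck_on k S (\<lambda>x. L (f x))"
  using assms(3)
proof (induction k arbitrary: f)
  case 0
  then show ?case using assms(2) by (auto intro: bounded_linear.continuous_on)
next
  case (Suc k)
  show ?case
  proof (rule Ck_on_SucI[OF assms(1)])
    show "((\<lambda>x. L (f x)) has_derivative (\<lambda>v. L (frechet_derivative f (at x) v))) (at x)"
      if "x \<in> S" for x
      using bounded_linear.has_derivative[OF assms(2) Ck_on_SucD(1)[OF Suc.prems that]] .
    show "Ck_on k S (\<lambda>x. L (frechet_derivative f (at x) v))" for v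
      using Suc by auto
  qed
qed

lemma Ck_on_linear:
  assumes "open S" "bounded_linear L"
  shows "Ck_on k S L"
proof (cases k)
  case 0
  then show ?thesis using assms(2) by (simp add: linear_continuous_on)
next
  case (Suc k)
  show ?thesis unfolding Suc
    by (rule Ck_on_SucI[where f' = "\<lambda>x. L"])
       (use assms in \<open>auto intro: bounded_linear_imp_has_derivative Ck_on_const\<close>)
qed

lemma Ck_on_add:
  assumes "open S" "Ck_on k S f" "Ck_on k S g"
  shows "Ck_on k S (\<lambda>x. f x + g x)"
  using assms(2,3)
proof (induction k arbitrary: f g)
  case 0
  then show ?case by (auto intro: continuous_on_add)
next
  case (Suc k)
  show ?case
  proof (rule Ck_on_SucI[OF assms(1) has_derivative_add])
    show "Ck_on k S (\<lambda>x. frechet_derivative f (at x) v + frechet_derivative g (at x) v)" for v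
      by (intro Suc.IH Ck_on_SucD(2)[OF Suc.prems(1)] Ck_on_SucD(2)[OF Suc.prems(2)])
  qed (rule Ck_on_SucD(1)[OF Suc.prems(1)] Ck_on_SucD(1)[OF Suc.prems(2)], assumption)+
qed

lemma Ck_on_scaleR:
  fixes f :: "'a::real_normed_vector \<Rightarrow> real"
  assumes "open S" "Ck_on k S f" "Ck_on k S g"
  shows "Ck_on k S (\<lambda>x. f x *\<^sub>R g x)"
  using assms(2,3)
proof (induction k arbitrary: f g)
  case 0
  then show ?case by (auto intro: continuous_on_scaleR)
next
  case (Suc k)
  show ?case
  proof (rule Ck_on_SucI[OF assms(1) has_derivative_scaleR])
    show "Ck_on k S (\<lambda>x. f x *\<^sub>R frechet_derivative g (at x) v + frechet_derivative f (at x) v *\<^sub>R g x)"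
      for v
      by (intro Ck_on_add[OF assms(1)] Suc.IH Ck_on_Suc_imp[OF Suc.prems(1)]
          Ck_on_Suc_imp[OF Suc.prems(2)] Ck_on_SucD(2)[OF Suc.prems(1)] Ck_on_SucD(2)[OF Suc.prems(2)])
  qed (rule Ck_on_SucD(1)[OF Suc.prems(1)] Ck_on_SucD(1)[OF Suc.prems(2)], assumption)+
qed

lemma Ck_on_mult:
  fixes f g :: "'a::real_normed_vector \<Rightarrow> real"
  shows "open S \<Longrightarrow> Ck_on k S f \<Longrightarrow> Ck_on k S g \<Longrightarrow> Ck_on k S (\<lambda>x. f x * g x)"
  using Ck_on_scaleR[of S k f g] by simp

lemma Ck_on_sum:
  assumes "open S" "\<And>i. i \<in> I \<Longrightarrow> Ck_on k S (f i)"
  shows "Ck_on k S (\<lambda>x. \<Sum>i\<in>I. f i x)"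
  using assms(2)
  by (induction I rule: infinite_finite_induct) (auto intro: Ck_on_const Ck_on_add[OF assms(1)])

lemma Ck_on_Pair:
  assumes "open S" "Ck_on k S f" "Ck_on k S g"
  shows "Ck_on k S (\<lambda>x. (f x, g x))"
proof -
  have 1: "bounded_linear (\<lambda>a::'b. (a, 0::'c))" "bounded_linear (\<lambda>a::'c. (0::'b, a))"
    by (auto intro!: bounded_linear_intros)
  show ?thesis
    using Ck_on_add[OF assms(1) Ck_on_linear_compose[OF assms(1) 1(1) assms(2)]
        Ck_on_linear_compose[OF assms(1) 1(2) assms(3)]] by simp
qed

lemma linear_eq_sum_Basis:
  fixes L :: "'a::euclidean_space \<Rightarrow> 'b::real_vector"
  assumes "linear L"
  shows "L x = (\<Sum>b\<in>Basis. (x \<bullet> b) *\<^sub>R L b)"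
proof -
  have "L (\<Sum>b\<in>Basis. (x \<bullet> b) *\<^sub>R b) = (\<Sum>b\<in>Basis. (x \<bullet> b) *\<^sub>R L b)"
    by (simp only: linear_sum[OF assms] linear_scale[OF assms])
  then show ?thesis by (simp only: euclidean_representation)
qed

text \<open>\<open>Ck_on\<close> controls derivatives along constant vectors only, but the chain
  rule applies the derivative of \<open>g\<close> to a vector that varies with the point. Expanding
  this vector in \<open>Basis\<close> leaves products of scalar functions with derivatives of
  \<open>g\<close> in fixed directions, to which the induction hypothesis applies. This is why the
  middle space is Euclidean.\<close>

lemma Ck_on_compose:
  fixes f :: "'a::real_normed_vector \<Rightarrow> 'b::euclidean_space" and g :: "'b \<Rightarrow> 'c::real_normed_vector"
  assumes "open S" "open T" "f ` S \<subseteq> T" "Ck_on k S f" "Ck_on k T g"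
  shows "Ck_on k S (\<lambda>x. g (f x))"
  using assms(4,5)
proof (induction k arbitrary: g)
  case 0
  then have "continuous_on T g" "continuous_on S f" by auto
  then show ?case using continuous_on_compose2[OF _ _ assms(3)] by simp
next
  case (Suc k)
  have D: "(f has_derivative frechet_derivative f (at x)) (at x)"
     "(g has_derivative frechet_derivative g (at (f x))) (at (f x))" if "x \<in> S" for x
    using Ck_on_SucD(1)[OF Suc.prems(1)] Ck_on_SucD(1)[OF Suc.prems(2)] that assms(3) by auto
  show ?case
  proof (rule Ck_on_SucI[OF assms(1)])
    fix x assume x: "x \<in> S"
    have "((\<lambda>x. g (f x)) has_derivative (\<lambda>v. frechet_derivative g (at (f x)) (frechet_derivative f (at x) v))) (at x)"
      using has_derivative_compose[OF D[OF x]] .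
    moreover have "frechet_derivative g (at (f x)) (frechet_derivative f (at x) v) =
        (\<Sum>b\<in>Basis. (frechet_derivative f (at x) v \<bullet> b) *\<^sub>R frechet_derivative g (at (f x)) b)" for v
      using linear_eq_sum_Basis[OF has_derivative_linear[OF D(2)[OF x]], of "frechet_derivative f (at x) v"]
      .
    ultimately show "((\<lambda>x. g (f x)) has_derivative
       (\<lambda>v. \<Sum>b\<in>Basis. (frechet_derivative f (at x) v \<bullet> b) *\<^sub>R frechet_derivative g (at (f x)) b)) (at x)"
      by simp
  next
    fix v
    show "Ck_on k S (\<lambda>x. \<Sum>b\<in>Basis. (frechet_derivative f (at x) v \<bullet> b) *\<^sub>R frechet_derivative g (at (f x)) b)"
    proof (rule Ck_on_sum[OF assms(1) Ck_on_scaleR[OF assms(1)]])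
      fix b :: 'b
      show "Ck_on k S (\<lambda>x. frechet_derivative f (at x) v \<bullet> b)"
        by (rule Ck_on_linear_compose[OF assms(1) bounded_linear_inner_left Ck_on_SucD(2)[OF Suc.prems(1)]])
      show "Ck_on k S (\<lambda>x. frechet_derivative g (at (f x)) b)"
        by (rule Suc.IH[OF Ck_on_Suc_imp[OF Suc.prems(1)] Ck_on_SucD(2)[OF Suc.prems(2)]])
    qed
  qed
qed

section \<open>Smoothness of infinite order\<close>

lemma smooth_onI: "(\<And>k. Ck_on k S f) \<Longrightarrow> smooth_on S f"
  by (simp add: smooth_on_def)

lemma smooth_onD: "smooth_on S f \<Longrightarrow> Ck_on k S f"
  by (simp add: smooth_on_def)

lemma smooth_on_has_derivative:
  "smooth_on S f \<Longrightarrow> x \<in> S \<Longrightarrow> (f has_derivative frechet_derivative f (at x)) (at x)"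
  by (rule Ck_on_SucD(1)[OF smooth_onD])

lemma smooth_on_linear_derivative:
  "smooth_on S f \<Longrightarrow> x \<in> S \<Longrightarrow> linear (frechet_derivative f (at x))"
  by (rule has_derivative_linear[OF smooth_on_has_derivative])

lemma smooth_on_imp_continuous_on: "smooth_on S f \<Longrightarrow> continuous_on S f"
  using Ck_on_imp_continuous_on smooth_onD by blast

lemma smooth_on_subset: "smooth_on S f \<Longrightarrow> T \<subseteq> S \<Longrightarrow> smooth_on T f"
  using Ck_on_subset unfolding smooth_on_def by blast

lemma smooth_on_mult:
  fixes f g :: "'a::real_normed_vector \<Rightarrow> real"
  shows "open S \<Longrightarrow> smooth_on S f \<Longrightarrow> smooth_on S g \<Longrightarrow> smooth_on S (\<lambda>x. f x * g x)"
  by (rule smooth_onI, rule Ck_on_mult[OF _ smooth_onD smooth_onD])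

lemma smooth_on_add:
  "open S \<Longrightarrow> smooth_on S f \<Longrightarrow> smooth_on S g \<Longrightarrow> smooth_on S (\<lambda>x. f x + g x)"
  by (rule smooth_onI, rule Ck_on_add[OF _ smooth_onD smooth_onD])

lemma smooth_on_linear: "open S \<Longrightarrow> bounded_linear L \<Longrightarrow> smooth_on S L"
  by (rule smooth_onI, rule Ck_on_linear)

lemma smooth_on_const: "smooth_on S (\<lambda>x. c)"
  by (simp add: Ck_on_const smooth_on_def)

lemma smooth_on_compose:
  fixes f :: "'a::real_normed_vector \<Rightarrow> 'b::euclidean_space" and g :: "'b \<Rightarrow> 'c::real_normed_vector"
  shows "open S \<Longrightarrow> open T \<Longrightarrow> f ` S \<subseteq> T \<Longrightarrow> smooth_on S f \<Longrightarrow> smooth_on T g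
    \<Longrightarrow> smooth_on S (\<lambda>x. g (f x))"
  by (rule smooth_onI, rule Ck_on_compose[of S T f _ g, OF _ _ _ smooth_onD smooth_onD])

subsection \<open>Bump functions\<close>

text \<open>\<open>flat 0\<close> is the classical \<open>exp (- (1 / t))\<close> extended by zero.
  The powers of \<open>1 / t\<close> are included because each derivative is then a linear
  combination of members of the family.\<close>

definition flat :: "nat \<Rightarrow> real \<Rightarrow> real" where
  "flat m t = (if t \<le> 0 then 0 else (1 / t) ^ m * exp (- (1 / t)))"

lemma flat_tendsto_0: "(flat m \<longlongrightarrow> 0) (at 0)"
proof -
  have "((\<lambda>t. (1 / t) ^ m * exp (- (1 / t))) \<longlongrightarrow> 0) (at_right (0::real))"
  proof -
    have 1: "((\<lambda>x::real. x ^ m / exp x) \<longlongrightarrow> 0) at_top" by (rule tendsto_power_div_exp_0)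
    have "((\<lambda>t::real. inverse t ^ m / exp (inverse t)) \<longlongrightarrow> 0) (at_right 0)"
      using filterlim_compose[OF 1 filterlim_inverse_at_top_right] .
    then show ?thesis by (simp add: exp_minus field_simps)
  qed
  then have "(flat m \<longlongrightarrow> 0) (at_right 0)"
    by (rule Lim_transform_eventually) (auto simp: flat_def eventually_at_filter)
  moreover have "(flat m \<longlongrightarrow> 0) (at_left 0)"
    by (rule Lim_transform_eventually[OF tendsto_const]) (auto simp: flat_def eventually_at_filter)
  ultimately show ?thesis by (simp add: filterlim_at_split)
qed

lemma flat_has_derivative:
  "(flat m has_real_derivative (flat (m + 2) t - real m * flat (m + 1) t)) (at t)"
proof -
  consider "t < 0" | "t = 0" | "t > 0" by linarith
  then show ?thesis
  proof cases
    case 1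
    have "((\<lambda>t. 0) has_real_derivative (flat (m + 2) t - real m * flat (m + 1) t)) (at t)"
      using 1 by (simp add: flat_def)
    then show ?thesis
      by (rule has_field_derivative_transform_within_open[where S="{..<0}"])
        (use 1 in \<open>auto simp: flat_def\<close>)
  next
    case 2
    \<comment> \<open>The difference quotient at \<open>0\<close> is \<open>flat (Suc m) h\<close>:
      the division by \<open>h\<close> adds one power of \<open>1 / h\<close>.\<close>
    have "((\<lambda>h. (flat m (0 + h) - flat m 0) / h) \<longlongrightarrow> 0) (at 0)"
      by (rule Lim_transform_eventually[OF flat_tendsto_0[of "Suc m"]])
        (auto simp: flat_def eventually_at_filter)
    then show ?thesis using 2 by (simp add: DERIV_def flat_def)
  next
    case 3
    have "((\<lambda>t. (1 / t) ^ m * exp (- (1 / t))) has_real_derivative (flat (m + 2) t - real m * flat (m + 1) t)) (at t)"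
    \<comment> \<open>The power rule lowers the exponent to \<open>m - 1\<close>, so
      \<open>m = 0\<close> is separate.\<close>
    proof (cases m)
      case 0
      then show ?thesis using 3
        by (auto intro!: derivative_eq_intros simp: flat_def field_simps power2_eq_square)
    next
      case (Suc n)
      have "((\<lambda>t. inverse t ^ m * exp (- inverse t)) has_real_derivative
         real m * inverse t ^ n * (- (inverse t ^ 2)) * exp (- inverse t)
         + inverse t ^ m * (exp (- inverse t) * inverse t ^ 2)) (at t)"
        using 3 Suc by (auto intro!: derivative_eq_intros simp: power2_eq_square simp del: power_Suc)
      then show ?thesis using 3 Suc
        by (simp add: flat_def divide_inverse power2_eq_square algebra_simps)
    qed
    then show ?thesis
      by (rule has_field_derivative_transform_within_open[where S="{0<..}"])
        (use 3 in \<open>auto simp: flat_def\<close>)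
  qed
qed

lemma Ck_on_flat: "Ck_on k UNIV (flat m)"
proof (induction k arbitrary: m)
  case 0
  have "isCont (flat m) t" for t using DERIV_isCont[OF flat_has_derivative] .
  then show ?case by (simp add: continuous_at_imp_continuous_on)
next
  case (Suc k)
  show ?case
  proof (rule Ck_on_SucI[where f' = "\<lambda>t. (*) (flat (m + 2) t - real m * flat (m + 1) t)"])
    show "(flat m has_derivative (*) (flat (m + 2) t - real m * flat (m + 1) t)) (at t)" for t
      using flat_has_derivative[of m t] unfolding has_field_derivative_def .
    have "Ck_on k UNIV (\<lambda>x. (flat (m + 2) x + (- real m) * flat (m + 1) x) * v)" for v
      by (intro Ck_on_mult[OF open_UNIV] Ck_on_add[OF open_UNIV] Suc.IH Ck_on_const)
    then show "Ck_on k UNIV (\<lambda>x. (flat (m + 2) x - real m * flat (m + 1) x) * v)" for v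
      by simp
  qed simp
qed

lemma flat_mono: "s \<le> t \<Longrightarrow> flat 0 s \<le> flat 0 t"
  by (cases "s \<le> 0") (simp_all add: flat_def frac_le)

text \<open>The composite \<open>flat 0 (flat 0 1 - flat 0 s)\<close> is constant for \<open>s \<le> 0\<close> because the inner function
  is flat there, and vanishes for \<open>s \<ge> 1\<close> because the outer one does.\<close>

lemma smooth_bump:
  fixes x :: "'a::euclidean_space"
  assumes "r > 0"
  obtains \<beta> :: "'a \<Rightarrow> real" and s where "0 < s" "s < r" "smooth_on UNIV \<beta>"
    "\<And>y. y \<in> ball x s \<Longrightarrow> \<beta> y = 1" "\<And>y. y \<notin> ball x r \<Longrightarrow> \<beta> y = 0"
proof -
  define c where "c = flat 0 1"
  \<comment> \<open>The scaling makes \<open>sg\<close> at most \<open>- 1 / 2\<close> on the ball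
    of radius \<open>r / 2\<close> and at least \<open>1\<close> outside the ball of radius
    \<open>r\<close>.\<close>
  define sg where "sg = (\<lambda>y. 2 * ((y - x) \<bullet> (y - x)) / r\<^sup>2 - 1)"
  define \<beta> where "\<beta> = (\<lambda>y. flat 0 (c - flat 0 (sg y)) / flat 0 c)"
  have c: "c > 0" "flat 0 c > 0" by (auto simp: c_def flat_def)
  have sqnorm: "(y - x) \<bullet> (y - x) = (dist x y)\<^sup>2" for y
    by (metis dist_commute dist_norm power2_norm_eq_inner)
  have sm: "smooth_on UNIV \<beta>"
  proof (rule smooth_onI)
    fix k
    have coord: "Ck_on k UNIV (\<lambda>y. y \<bullet> b + (- (x \<bullet> b)))" for b
      by (intro Ck_on_add open_UNIV Ck_on_const Ck_on_linear bounded_linear_inner_left)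
    have "Ck_on k UNIV (\<lambda>y::'a. (\<Sum>b\<in>Basis. (y \<bullet> b + (- (x \<bullet> b))) * (y \<bullet> b + (- (x \<bullet> b)))) * (2 / r\<^sup>2) + (- 1))"
      by (intro Ck_on_mult Ck_on_add Ck_on_sum Ck_on_const open_UNIV coord)
    moreover have "sg = (\<lambda>y. (\<Sum>b\<in>Basis. (y \<bullet> b + (- (x \<bullet> b))) * (y \<bullet> b + (- (x \<bullet> b)))) * (2 / r\<^sup>2) + (- 1))"
      unfolding sg_def euclidean_inner[of "_ - x" "_ - x"] by (simp add: inner_diff_left mult.commute)
    ultimately have sg: "Ck_on k UNIV sg" by simp
    have flat_compose: "Ck_on k UNIV (\<lambda>y::'a. flat 0 (h y))" if "Ck_on k UNIV h" for h
      by (rule Ck_on_compose[OF open_UNIV open_UNIV subset_UNIV that Ck_on_flat])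
    have inner: "Ck_on k UNIV (\<lambda>y. c + (-1) * flat 0 (sg y))"
      by (intro Ck_on_mult Ck_on_add Ck_on_const open_UNIV flat_compose sg)
    have "Ck_on k UNIV (\<lambda>y. flat 0 (c + (-1) * flat 0 (sg y)) * (1 / flat 0 c))"
      by (rule Ck_on_mult[OF open_UNIV flat_compose[OF inner] Ck_on_const])
    then show "Ck_on k UNIV \<beta>" by (simp add: \<beta>_def)
  qed
  show thesis
  proof (rule that[OF _ _ sm])
    show "0 < r / 2" "r / 2 < r" using assms by auto
    show "\<beta> y = 1" if "y \<in> ball x (r / 2)" for y
    proof -
      have "(dist x y)\<^sup>2 \<le> (r / 2)\<^sup>2" using that by (intro power_mono) auto
      then have "(dist x y)\<^sup>2 \<le> r\<^sup>2 / 4" by (simp add: power_divide)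
      then have "2 * (dist x y)\<^sup>2 \<le> r\<^sup>2" using zero_le_power2[of "dist x y"] by linarith
      then have "sg y \<le> 0" using assms unfolding sg_def sqnorm by simp
      then have "flat 0 (sg y) = 0" by (simp add: flat_def)
      then show ?thesis using c by (simp add: \<beta>_def)
    qed
    show "\<beta> y = 0" if "y \<notin> ball x r" for y
    proof -
      have "(dist x y)\<^sup>2 \<ge> r\<^sup>2" using that assms by (intro power_mono) auto
      then have "sg y \<ge> 1" using assms unfolding sg_def sqnorm by (simp add: field_simps)
      then have "flat 0 (sg y) \<ge> c" using flat_mono c_def by blast
      then show ?thesis by (simp add: \<beta>_def flat_def)
    qed
  qed
qed

text \<open>Since \<open>r < R\<close>, the open sets \<open>ball x R\<close> and
  \<open>- cball x r\<close> cover the space. The function is a product of smooth functions on the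
  first and zero on the second.\<close>

lemma smooth_on_cutoff:
  fixes x :: "'a::euclidean_space"
  assumes "smooth_on (ball x R) F" "smooth_on UNIV \<beta>" "r < R" "\<And>y. y \<notin> ball x r \<Longrightarrow> \<beta> y = 0"
  shows "smooth_on UNIV (\<lambda>y. if y \<in> ball x R then \<beta> y * F y else (0::real))" (is "smooth_on _ ?f")
proof (rule smooth_onI)
  fix k
  have 1: "Ck_on k (ball x R) ?f"
    by (rule Ck_on_cong[OF _ _ Ck_on_mult[of "ball x R" k \<beta> F]])
       (use assms Ck_on_subset[OF smooth_onD[OF assms(2)]] smooth_onD in auto)
  have "\<beta> y = 0" if "y \<in> - cball x r" for y using that assms(4) by auto
  then have 2: "Ck_on k (- cball x r) ?f"
    by (intro Ck_on_cong[OF _ _ Ck_on_const[of _ _ 0]]) auto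
  have "ball x R \<union> - cball x r = UNIV" using assms(3) by auto
  then show "Ck_on k UNIV ?f" using Ck_on_Un[OF _ _ 1 2] by auto
qed

subsection \<open>Hadamard's lemma\<close>

lemma segment_in_ball:
  fixes x y :: "'a::real_normed_vector"
  assumes "y \<in> ball x r" "t \<in> {0..1}"
  shows "x + t *\<^sub>R (y - x) \<in> ball x r"
proof -
  have "\<bar>t\<bar> * norm (y - x) \<le> 1 * norm (y - x)" using assms by (intro mult_right_mono) auto
  then show ?thesis using assms by (simp add: dist_norm norm_minus_commute)
qed

lemma continuous_on_segment:
  fixes F :: "'a::euclidean_space \<Rightarrow> real"
  assumes "continuous_on (ball x r) F"
  shows "continuous_on (ball x r \<times> {0..1}) (\<lambda>(y, t). t ^ m * F (x + t *\<^sub>R (y - x)))"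
proof -
  have "continuous_on (ball x r \<times> {0..1}) (\<lambda>z. snd z ^ m * F (x + snd z *\<^sub>R (fst z - x)))"
    by (intro continuous_intros continuous_on_compose2[OF assms])
      (auto simp del: mem_ball intro: segment_in_ball)
  then show ?thesis by (simp add: case_prod_beta)
qed

text \<open>The power of \<open>t\<close> makes the statement inductive: each derivative produces another factor \<open>t\<close>.\<close>

lemma Ck_on_segment_integral:
  fixes F :: "'a::euclidean_space \<Rightarrow> real"
  assumes "Ck_on k (ball x r) F"
  shows "Ck_on k (ball x r) (\<lambda>y. integral {0..1} (\<lambda>t. t ^ m * F (x + t *\<^sub>R (y - x))))"
  using assms
proof (induction k arbitrary: F m)
  case 0
  have "continuous_on (ball x r \<times> cbox 0 1) (\<lambda>(y, t). t ^ m * F (x + t *\<^sub>R (y - x)))"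
    using continuous_on_segment 0 by auto
  from integral_continuous_on_param[OF this] show ?case by simp
next
  case (Suc k)
  define DF where "DF = (\<lambda>y. frechet_derivative F (at y))"
  have DF: "(F has_derivative DF y) (at y)" if "y \<in> ball x r" for y
    unfolding DF_def using Ck_on_SucD(1)[OF Suc.prems that] .
  \<comment> \<open>The rule for differentiating under the integral needs the derivative as a
    continuous family of bounded operators. In finite dimension this continuity can be checked one
    basis vector at a time.\<close>
  define B where "B = (\<lambda>y t. Blinfun (\<lambda>v. t ^ Suc m * DF (x + t *\<^sub>R (y - x)) v))"
  have B: "blinfun_apply (B y t) = (\<lambda>v. t ^ Suc m * DF (x + t *\<^sub>R (y - x)) v)"
    if "y \<in> ball x r" "t \<in> cbox 0 1" for y t
  proof -
    have "x + t *\<^sub>R (y - x) \<in> ball x r" by (rule segment_in_ball) (use that in auto)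
    from bounded_linear_const_mult[OF has_derivative_bounded_linear[OF DF[OF this]]]
    show ?thesis unfolding B_def by (rule bounded_linear_Blinfun_apply)
  qed
  have cDF: "continuous_on (ball x r) (\<lambda>y. DF y v)" for v
    unfolding DF_def using Ck_on_imp_continuous_on[OF Ck_on_SucD(2)[OF Suc.prems]] .
  have cF: "continuous_on (ball x r) F" using Ck_on_imp_continuous_on[OF Suc.prems] .
  have cB: "continuous_on (ball x r \<times> cbox 0 1) (\<lambda>(y, t). B y t)"
  proof (rule continuous_on_blinfun_componentwise)
    fix i :: 'a
    show "continuous_on (ball x r \<times> cbox 0 1) (\<lambda>z. blinfun_apply (case z of (y, t) \<Rightarrow> B y t) i)"
      by (rule continuous_on_eq[OF continuous_on_segment[OF cDF[of i], of "Suc m"], simplified cbox_interval[symmetric]])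
         (auto simp: B simp del: mem_ball)
  qed
  have c1: "(\<lambda>t. t ^ j * H (x + t *\<^sub>R (y - x))) integrable_on cbox 0 1"
    if "continuous_on (ball x r) H" "y \<in> ball x r" for j y and H :: "'a \<Rightarrow> real"
  proof -
    have "continuous_on (cbox 0 1) (\<lambda>t. t ^ j * H (x + t *\<^sub>R (y - x)))"
      by (intro continuous_intros continuous_on_compose2[OF that(1)])
        (use segment_in_ball[OF that(2)] in auto)
    then show ?thesis by (rule integrable_continuous)
  qed
  show ?case
  proof (rule Ck_on_SucI)
    fix y assume y: "y \<in> ball x r"
    have "((\<lambda>y. integral (cbox 0 1) (\<lambda>t. t ^ m * F (x + t *\<^sub>R (y - x)))) has_derivative
        integral (cbox 0 1) (B y)) (at y within ball x r)"
    proof (rule leibniz_rule[OF _ _ cB y convex_ball])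
      fix y t assume yt: "y \<in> ball x r" "t \<in> cbox 0 (1::real)"
      have F: "(F has_derivative DF (x + t *\<^sub>R (y - x))) (at (x + t *\<^sub>R (y - x)))"
        by (rule DF) (use yt segment_in_ball in auto)
      have L: "linear (DF (x + t *\<^sub>R (y - x)))" using F has_derivative_linear by blast
      have "((\<lambda>y. F (x + t *\<^sub>R (y - x))) has_derivative
         (\<lambda>v. DF (x + t *\<^sub>R (y - x)) (t *\<^sub>R v))) (at y within ball x r)"
        by (rule has_derivative_compose[where f = "\<lambda>y. x + t *\<^sub>R (y - x)" and f' = "(*\<^sub>R) t", OF _ F])
          (auto intro!: derivative_eq_intros)
      then have "((\<lambda>y. t ^ m * F (x + t *\<^sub>R (y - x))) has_derivative
         (\<lambda>v. t ^ m * DF (x + t *\<^sub>R (y - x)) (t *\<^sub>R v))) (at y within ball x r)"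
        by (rule has_derivative_mult_right)
      then show "((\<lambda>y. t ^ m * F (x + t *\<^sub>R (y - x))) has_derivative blinfun_apply (B y t))
          (at y within ball x r)"
        by (simp only: B[OF yt]) (simp add: linear_scale[OF L] mult_ac)
    next
      fix y assume "y \<in> ball x r"
      then show "(\<lambda>t. t ^ m * F (x + t *\<^sub>R (y - x))) integrable_on cbox 0 1" by (rule c1[OF cF])
    qed
    moreover have "blinfun_apply (integral (cbox 0 1) (B y)) =
        (\<lambda>v. integral {0..1} (\<lambda>t. t ^ Suc m * DF (x + t *\<^sub>R (y - x)) v))"
    proof
      fix v
      have "continuous_on (cbox 0 1) (\<lambda>t. case (y, t) of (y, t) \<Rightarrow> B y t)"
        by (rule continuous_on_compose2[OF cB]) (use y in \<open>auto intro!: continuous_intros\<close>)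
      then have "continuous_on (cbox 0 1) (B y)" by simp
      then have "(integral (cbox 0 1) (B y)) v = integral (cbox 0 1) (\<lambda>t. B y t v)"
        by (intro blinfun_apply_integral integrable_continuous)
      also have "\<dots> = integral (cbox 0 1) (\<lambda>t. t ^ Suc m * DF (x + t *\<^sub>R (y - x)) v)"
        by (rule integral_cong) (use B y in auto)
      finally show "integral (cbox 0 1) (B y) v =
        integral {0..1} (\<lambda>t. t ^ Suc m * DF (x + t *\<^sub>R (y - x)) v)" by simp
    qed
    ultimately show "((\<lambda>y. integral {0..1} (\<lambda>t. t ^ m * F (x + t *\<^sub>R (y - x)))) has_derivative
       (\<lambda>v. integral {0..1} (\<lambda>t. t ^ Suc m * DF (x + t *\<^sub>R (y - x)) v))) (at y)"
      using y at_within_open[OF y open_ball] by simp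
  next
    show "Ck_on k (ball x r) (\<lambda>y. integral {0..1} (\<lambda>t. t ^ Suc m * DF (x + t *\<^sub>R (y - x)) v))" for v
      by (rule Suc.IH) (use Suc.prems in \<open>simp add: DF_def\<close>)
  qed simp
qed

text \<open>Integrating the derivative of \<open>F\<close> along the segment from \<open>x\<close>
  to \<open>y\<close> gives \<open>F y - F x\<close>; expanding \<open>y - x\<close> in
  \<open>Basis\<close> pulls the coordinate differences out of the integral. At \<open>y = x\<close>
  the integrand is constant, which gives the value of \<open>G b x\<close>.\<close>

lemma hadamard:
  fixes F :: "'a::euclidean_space \<Rightarrow> real"
  assumes "r > 0" "smooth_on (ball x r) F"
  obtains G where "\<And>b. smooth_on (ball x r) (G b)"
    "\<And>b. G b x = frechet_derivative F (at x) b"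
    "\<And>y. y \<in> ball x r \<Longrightarrow> F y = F x + (\<Sum>b\<in>Basis. (y \<bullet> b - x \<bullet> b) * G b y)"
proof
  define DF where "DF = (\<lambda>y. frechet_derivative F (at y))"
  let ?G = "\<lambda>b y. integral {0..1} (\<lambda>t. t ^ 0 * DF (x + t *\<^sub>R (y - x)) b)"
  have DF: "(F has_derivative DF y) (at y)" if "y \<in> ball x r" for y
    unfolding DF_def using smooth_on_has_derivative[OF assms(2) that] .
  have sDF: "smooth_on (ball x r) (\<lambda>y. DF y b)" for b
    unfolding DF_def by (rule smooth_onI[OF Ck_on_SucD(2)[OF smooth_onD[OF assms(2)]]])
  show "smooth_on (ball x r) (?G b)" for b
    by (rule smooth_onI[OF Ck_on_segment_integral[OF smooth_onD[OF sDF]]])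
  show "?G b x = frechet_derivative F (at x) b" for b by (simp add: DF_def)
  fix y assume y: "y \<in> ball x r"
  have "((\<lambda>t. DF (x + t *\<^sub>R (y - x)) (y - x)) has_integral
      (F (x + 1 *\<^sub>R (y - x)) - F (x + 0 *\<^sub>R (y - x)))) {0..1}"
  proof (rule fundamental_theorem_of_calculus)
    fix t :: real assume t: "t \<in> {0..1}"
    have L: "linear (DF (x + t *\<^sub>R (y - x)))" 
      using DF[OF segment_in_ball[OF y t]] has_derivative_linear by blast
    have "((\<lambda>t. F (x + t *\<^sub>R (y - x))) has_derivative
         (\<lambda>s. DF (x + t *\<^sub>R (y - x)) (s *\<^sub>R (y - x)))) (at t within {0..1})"
      by (rule has_derivative_compose[where f = "\<lambda>t. x + t *\<^sub>R (y - x)" and f' = "\<lambda>s. s *\<^sub>R (y - x)",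
            OF _ DF[OF segment_in_ball[OF y t]]])
        (auto intro!: derivative_eq_intros)
    then show "((\<lambda>t. F (x + t *\<^sub>R (y - x))) has_vector_derivative
        DF (x + t *\<^sub>R (y - x)) (y - x)) (at t within {0..1})"
      unfolding has_vector_derivative_def by (simp only: linear_scale[OF L])
  qed simp
  then have "F y - F x = integral {0..1} (\<lambda>t. DF (x + t *\<^sub>R (y - x)) (y - x))"
    by (simp add: integral_unique)
  also have "\<dots> = integral {0..1} (\<lambda>t. \<Sum>b\<in>Basis. (y \<bullet> b - x \<bullet> b) * DF (x + t *\<^sub>R (y - x)) b)"
  proof (rule integral_cong)
    fix t :: real assume t: "t \<in> {0..1}"
    show "DF (x + t *\<^sub>R (y - x)) (y - x) = (\<Sum>b\<in>Basis. (y \<bullet> b - x \<bullet> b) * DF (x + t *\<^sub>R (y - x)) b)"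
      using linear_eq_sum_Basis[OF has_derivative_linear[OF DF[OF segment_in_ball[OF y t]]], of "y - x"]
      by (simp add: inner_diff_left)
  qed
  also have "\<dots> = (\<Sum>b\<in>Basis. integral {0..1} (\<lambda>t. (y \<bullet> b - x \<bullet> b) * DF (x + t *\<^sub>R (y - x)) b))"
  proof (rule integral_sum)
    fix b :: 'a
    have "continuous_on {0..1} (\<lambda>t. DF (x + t *\<^sub>R (y - x)) b)"
      by (intro continuous_intros continuous_on_compose2[OF smooth_on_imp_continuous_on[OF sDF]])
        (use segment_in_ball[OF y] in auto)
    then show "(\<lambda>t. (y \<bullet> b - x \<bullet> b) * DF (x + t *\<^sub>R (y - x)) b) integrable_on {0..1}"
      by (intro integrable_continuous_real continuous_intros)
  qed simp
  finally show "F y = F x + (\<Sum>b\<in>Basis. (y \<bullet> b - x \<bullet> b) * ?G b y)" by simp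
qed

subsection \<open>Smooth functions on subsets\<close>

lemma smooth_fun_global: "smooth_on UNIV F \<Longrightarrow> smooth_fun A F"
  unfolding smooth_fun_def by blast

lemma smooth_fun_const: "smooth_fun A (\<lambda>y. c)"
  by (rule smooth_fun_global[OF smooth_on_const])

lemma smooth_fun_linear: "bounded_linear F \<Longrightarrow> smooth_fun A F"
  by (rule smooth_fun_global[OF smooth_on_linear[OF open_UNIV]])

lemma smooth_fun_binary:
  fixes A :: "'a::real_normed_vector set"
  assumes "\<And>(V :: 'a set) F G. open V \<Longrightarrow> smooth_on V F \<Longrightarrow> smooth_on V G \<Longrightarrow> smooth_on V (\<lambda>y. h (F y) (G y))"
    and "smooth_fun A f" "smooth_fun A g"
  shows "smooth_fun A (\<lambda>y. h (f y) (g y))"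
  unfolding smooth_fun_def
proof
  fix x assume x: "x \<in> A"
  obtain V F where V: "open V" "x \<in> V" "smooth_on V F" "\<forall>y\<in>A \<inter> V. f y = F y"
    using assms(2) x unfolding smooth_fun_def by blast
  obtain W G where W: "open W" "x \<in> W" "smooth_on W G" "\<forall>y\<in>A \<inter> W. g y = G y"
    using assms(3) x unfolding smooth_fun_def by blast
  have "smooth_on (V \<inter> W) (\<lambda>y. h (F y) (G y))"
    by (rule assms(1)[OF open_Int[OF V(1) W(1)] smooth_on_subset[OF V(3)] smooth_on_subset[OF W(3)]]) auto
  then show "\<exists>V F. open V \<and> x \<in> V \<and> smooth_on V F \<and> (\<forall>y\<in>A \<inter> V. h (f y) (g y) = F y)"
    using V W by (intro exI[of _ "V \<inter> W"] exI[of _ "\<lambda>y. h (F y) (G y)"]) auto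
qed

lemma smooth_fun_mult: "smooth_fun A f \<Longrightarrow> smooth_fun A g \<Longrightarrow> smooth_fun A (\<lambda>y. f y * g y)"
  by (rule smooth_fun_binary[where h = "(*)", OF smooth_on_mult])

lemma smooth_fun_add: "smooth_fun A f \<Longrightarrow> smooth_fun A g \<Longrightarrow> smooth_fun A (\<lambda>y. f y + g y)"
  by (rule smooth_fun_binary[where h = "(+)", OF smooth_on_add])

lemma smooth_fun_sum:
  "(\<And>i. i \<in> I \<Longrightarrow> smooth_fun A (f i)) \<Longrightarrow> smooth_fun A (\<lambda>y. \<Sum>i\<in>I. f i y)"
proof (induction I rule: infinite_finite_induct)
  case (insert i I)
  then have "smooth_fun A (\<lambda>y. f i y + (\<Sum>i\<in>I. f i y))" by (intro smooth_fun_add) auto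
  then show ?case using insert.hyps by simp
qed (simp_all add: smooth_fun_const)

text \<open>Multiplication by a bump function changes \<open>F\<close> away from \<open>x\<close>
  but not its germ at \<open>x\<close>. The product is smooth on the whole ambient space, hence on
  every \<open>M\<close>.\<close>

lemma smooth_fun_extension:
  fixes x :: "'a::euclidean_space"
  assumes "open V" "x \<in> V" "smooth_on V F"
  obtains a W where "smooth_fun M a" "open W" "x \<in> W" "W \<subseteq> V" "\<And>y. y \<in> W \<Longrightarrow> a y = (F y :: real)"
proof -
  obtain R where R: "R > 0" "ball x R \<subseteq> V" using assms open_contains_ball by blast
  then obtain \<beta> :: "'a \<Rightarrow> real" and s where b: "0 < s" "s < R / 2" "smooth_on UNIV \<beta>"
    "\<And>y. y \<in> ball x s \<Longrightarrow> \<beta> y = 1" "\<And>y. y \<notin> ball x (R / 2) \<Longrightarrow> \<beta> y = 0"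
    using smooth_bump[of "R / 2" x] by (metis half_gt_zero)
  let ?a = "\<lambda>y. if y \<in> ball x R then \<beta> y * F y else 0"
  have "smooth_on UNIV ?a"
    by (rule smooth_on_cutoff[where r = "R / 2"]) (use R b(3,5) smooth_on_subset[OF assms(3)] in auto)
  then show thesis
    by (rule that[OF smooth_fun_global, of ?a "ball x s"]) (use b R in auto)
qed

subsection \<open>Derivations and Poisson brackets\<close>

text \<open>Multiplying Hadamard's expansion of \<open>F\<close> by a cutoff \<open>\<beta>\<close> with \<open>\<beta> x = 1\<close> turns it into an identity
  between globally smooth functions; the Leibniz rule applied to both sides gives the claim.\<close>

lemma point_derivation_eq:
  fixes D :: "('a::euclidean_space \<Rightarrow> real) \<Rightarrow> real"
  assumes cong: "\<And>f g. smooth_fun M f \<Longrightarrow> smooth_fun M g \<Longrightarrow> (\<forall>y\<in>M. f y = g y) \<Longrightarrow> D f = D g"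
    and lin: "\<And>a b f g. smooth_fun M f \<Longrightarrow> smooth_fun M g \<Longrightarrow> D (\<lambda>y. a * f y + b * g y) = a * D f + b * D g"
    and leib: "\<And>f g. smooth_fun M f \<Longrightarrow> smooth_fun M g \<Longrightarrow> D (\<lambda>y. f y * g y) = f x * D g + D f * g x"
    and x: "x \<in> M" and f: "smooth_fun M f"
    and V: "open V" "x \<in> V" "smooth_on V F" "\<forall>y\<in>M \<inter> V. f y = F y"
  shows "D f = (\<Sum>b\<in>Basis. frechet_derivative F (at x) b * D (\<lambda>y. y \<bullet> b))"
proof -
  obtain R where R: "R > 0" "ball x R \<subseteq> V" using V open_contains_ball by blast
  then obtain \<beta> :: "'a \<Rightarrow> real" and s where b: "0 < s" "s < R / 2" "smooth_on UNIV \<beta>"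
    "\<And>y. y \<in> ball x s \<Longrightarrow> \<beta> y = 1" "\<And>y. y \<notin> ball x (R / 2) \<Longrightarrow> \<beta> y = 0"
    using smooth_bump[of "R / 2" x] by (metis half_gt_zero)
  have \<beta>x: "\<beta> x = 1" using b(1,4) by simp
  obtain G where G: "\<And>b. smooth_on (ball x R) (G b)"
    "\<And>b. G b x = frechet_derivative F (at x) b"
    "\<And>y. y \<in> ball x R \<Longrightarrow> F y = F x + (\<Sum>b\<in>Basis. (y \<bullet> b - x \<bullet> b) * G b y)"
    using hadamard[OF R(1) smooth_on_subset[OF V(3) R(2)]] by blast
  define g where "g = (\<lambda>b y. if y \<in> ball x R then \<beta> y * G b y else 0)"
  have sg: "smooth_fun M (g b)" for b
    unfolding g_def
    by (rule smooth_fun_global[OF smooth_on_cutoff[where r = "R / 2"]]) (use R b(3,5) G(1) in auto)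
  have gx: "g b x = frechet_derivative F (at x) b" for b using R(1) \<beta>x G(2) by (simp add: g_def)
  note s1 = smooth_fun_const[of M "1 :: real"]
  \<comment> \<open>\<open>1 = 1 * 1\<close> and the Leibniz rule give
    \<open>D 1 = D 1 + D 1\<close>.\<close>
  have one: "D (\<lambda>y. 1) = 0" using leib[OF s1 s1] by simp
  \<comment> \<open>The shape \<open>1 * h y + (- c) * 1\<close> of \<open>h - c\<close> is
    literally that of the linearity hypothesis.\<close>
  have sh: "smooth_fun M (\<lambda>y. 1 * h y + (- c) * 1)" if "smooth_fun M h" for h c
    by (intro smooth_fun_add smooth_fun_mult smooth_fun_const that)
  have shift: "D (\<lambda>y. 1 * h y + (- c) * 1) = D h" if "smooth_fun M h" for h c
    using lin[OF that s1, where a = 1 and b = "- c"] one by simp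
  have sum: "D (\<lambda>y. \<Sum>b\<in>B. k b y) = (\<Sum>b\<in>B. D (k b))"
    if "finite B" "\<And>b. smooth_fun M (k b)" for B and k :: "'a \<Rightarrow> 'a \<Rightarrow> real"
    using that(1)
  proof (induction B)
    case empty
    show ?case using lin[OF s1 s1, where a = 0 and b = 0] by simp
  next
    case (insert b B)
    have "smooth_fun M (\<lambda>y. \<Sum>b\<in>B. k b y)" by (intro smooth_fun_sum that)
    from lin[OF that(2) this, where a = 1 and b = 1] insert show ?case by simp
  qed
  have coord: "smooth_fun M (\<lambda>y. y \<bullet> b)" for b :: 'a by (intro smooth_fun_linear bounded_linear_inner_left)
  have s\<beta>: "smooth_fun M \<beta>" by (rule smooth_fun_global[OF b(3)])
  \<comment> \<open>In the Leibniz rule the term with \<open>D \<beta>\<close> is multiplied by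
    \<open>f x - F x = 0\<close>, and the other term has the factor
    \<open>\<beta> x = 1\<close>.\<close>
  have "D f = D (\<lambda>y. \<beta> y * (1 * f y + (- F x) * 1))"
    using leib[OF s\<beta> sh[OF f, where c = "F x"]] shift[OF f, where c = "F x"] \<beta>x V(2,4) x by simp
  also have "\<dots> = D (\<lambda>y. \<Sum>b\<in>Basis. (1 * (y \<bullet> b) + (- (x \<bullet> b)) * 1) * g b y)"
  proof (rule cong)
    show "smooth_fun M (\<lambda>y. \<beta> y * (1 * f y + (- F x) * 1))" by (intro smooth_fun_mult s\<beta> sh f)
    show "smooth_fun M (\<lambda>y. \<Sum>b\<in>Basis. (1 * (y \<bullet> b) + (- (x \<bullet> b)) * 1) * g b y)"
      by (intro smooth_fun_sum smooth_fun_mult sg sh coord)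
    show "\<forall>y\<in>M. \<beta> y * (1 * f y + (- F x) * 1) = (\<Sum>b\<in>Basis. (1 * (y \<bullet> b) + (- (x \<bullet> b)) * 1) * g b y)"
    proof
      fix y assume y: "y \<in> M"
      show "\<beta> y * (1 * f y + (- F x) * 1) = (\<Sum>b\<in>Basis. (1 * (y \<bullet> b) + (- (x \<bullet> b)) * 1) * g b y)"
      proof (cases "y \<in> ball x R")
        case True
        then have "f y = F x + (\<Sum>b\<in>Basis. (y \<bullet> b - x \<bullet> b) * G b y)" using G(3) V(4) R(2) y by auto
        with True show ?thesis by (simp add: g_def sum_distrib_left mult_ac)
      next
        case False
        then have "\<beta> y = 0" by (intro b(5)) (use R(1) in auto)
        with False show ?thesis by (simp add: g_def)
      qed
    qed
  qed
  also have "\<dots> = (\<Sum>b\<in>Basis. D (\<lambda>y. (1 * (y \<bullet> b) + (- (x \<bullet> b)) * 1) * g b y))"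
    by (intro sum smooth_fun_mult sg sh coord) simp
  also have "\<dots> = (\<Sum>b\<in>Basis. frechet_derivative F (at x) b * D (\<lambda>y. y \<bullet> b))"
  proof (rule sum.cong)
    \<comment> \<open>The coordinate difference vanishes at \<open>x\<close>, so only its derivative
      times \<open>g b x\<close> survives.\<close>
    fix b :: 'a
    show "D (\<lambda>y. (1 * (y \<bullet> b) + (- (x \<bullet> b)) * 1) * g b y) = frechet_derivative F (at x) b * D (\<lambda>y. y \<bullet> b)"
      using leib[OF sh[OF coord[of b], where c = "x \<bullet> b"] sg[of b]] shift[OF coord[of b], where c = "x \<bullet> b"] gx[of b] by simp
  qed simp
  finally show ?thesis .
qed

context
  fixes M :: "'a::euclidean_space set" and br x
  assumes br: "poisson_structure M br" and x: "x \<in> M"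
begin

lemma poisson_antisym: "smooth_fun M u \<Longrightarrow> smooth_fun M v \<Longrightarrow> br u v x = - br v u x"
  by (rule br[unfolded poisson_structure_def, THEN conjunct2, THEN conjunct2, THEN conjunct2,
        THEN conjunct1, rule_format]) (use x in auto)

lemma poisson_left_eq:
  assumes "smooth_fun M f" "smooth_fun M w"
    and V: "open V" "x \<in> V" "smooth_on V F" "\<forall>y\<in>M \<inter> V. f y = F y"
  shows "br f w x = (\<Sum>b\<in>Basis. frechet_derivative F (at x) b * br (\<lambda>y. y \<bullet> b) w x)"
proof (rule point_derivation_eq[where D = "\<lambda>f. br f w x" and M = M, OF _ _ _ x assms(1) V])
  note P = br[unfolded poisson_structure_def, THEN conjunct2]
  show "br f w x = br g w x" if "smooth_fun M f" "smooth_fun M g" "\<forall>y\<in>M. f y = g y" for f g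
    by (rule P[THEN conjunct1, rule_format]) (use that assms(2) x in auto)
  show "br (\<lambda>y. a * f y + b * g y) w x = a * br f w x + b * br g w x"
    if "smooth_fun M f" "smooth_fun M g" for a b f g
    by (rule P[THEN conjunct2, THEN conjunct1, rule_format]) (use that assms(2) x in auto)
  show "br (\<lambda>y. f y * g y) w x = f x * br g w x + br f w x * g x"
    if "smooth_fun M f" "smooth_fun M g" for f g
    by (rule P[THEN conjunct2, THEN conjunct2, THEN conjunct2, THEN conjunct1, rule_format])
      (use that assms(2) x in auto)
qed

text \<open>The brackets of the ambient coordinate functions are the components of the Poisson
  bivector at \<open>x\<close>. Antisymmetry carries the expansion of the left argument over to the
  right one.\<close>

lemma poisson_eq:
  assumes f: "smooth_fun M f" and g: "smooth_fun M g"
    and V: "open V" "x \<in> V" "smooth_on V F" "\<forall>y\<in>M \<inter> V. f y = F y"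
    and W: "open W" "x \<in> W" "smooth_on W G" "\<forall>y\<in>M \<inter> W. g y = G y"
  shows "br f g x = (\<Sum>i\<in>Basis. \<Sum>j\<in>Basis. frechet_derivative F (at x) i * frechet_derivative G (at x) j
      * br (\<lambda>y. y \<bullet> i) (\<lambda>y. y \<bullet> j) x)"
proof -
  have coord: "smooth_fun M (\<lambda>y. y \<bullet> b)" for b :: 'a by (intro smooth_fun_linear bounded_linear_inner_left)
  have "br (\<lambda>y. y \<bullet> i) g x = (\<Sum>j\<in>Basis. frechet_derivative G (at x) j * br (\<lambda>y. y \<bullet> i) (\<lambda>y. y \<bullet> j) x)" for i
    unfolding poisson_antisym[OF coord[of i] g] poisson_left_eq[OF g coord W] sum_negf[symmetric]
    by (rule sum.cong) (simp_all add: poisson_antisym[OF coord[of i] coord])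
  then show ?thesis
    unfolding poisson_left_eq[OF f g V] by (simp add: sum_distrib_left mult.assoc)
qed

text \<open>The right-hand side depends on \<open>F\<close> and \<open>G\<close> but not on the
  global representatives of the germs. Hence all representatives give one value, and the definite
  description is well defined; cutting off \<open>F\<close> and \<open>G\<close> shows that
  representatives exist.\<close>

lemma local_bracket_eq:
  assumes V: "open V" "x \<in> V" "smooth_on V F" "\<forall>y\<in>M \<inter> V. u y = F y"
    and W: "open W" "x \<in> W" "smooth_on W G" "\<forall>y\<in>M \<inter> W. v y = G y"
  shows "local_bracket M br u v x = (\<Sum>i\<in>Basis. \<Sum>j\<in>Basis. frechet_derivative F (at x) i
      * frechet_derivative G (at x) j * br (\<lambda>y. y \<bullet> i) (\<lambda>y. y \<bullet> j) x)" (is "_ = ?s")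
  unfolding local_bracket_def
proof (rule the_equality)
  have ext: "\<exists>a. smooth_fun M a \<and> same_germ M x a h"
    if VH: "open V" "x \<in> V" "smooth_on V H" "\<forall>y\<in>M \<inter> V. h y = H y" for V H h
  proof -
    obtain a T where a: "smooth_fun M a" "open T" "x \<in> T" "T \<subseteq> V" "\<And>y. y \<in> T \<Longrightarrow> a y = H y"
      by (rule smooth_fun_extension[OF VH(1-3), of M]) blast
    then have "same_germ M x a h"
      unfolding same_germ_def using x VH(4) by (intro exI[of _ "M \<inter> T"]) (auto simp: openin_open)
    then show ?thesis using a by blast
  qed
  have eq: "br a b x = ?s"
    if ab: "smooth_fun M a" "smooth_fun M b" "same_germ M x a u" "same_germ M x b v" for a b
  proof -
    have germ: "\<exists>T. open T \<and> x \<in> T \<and> (\<forall>y\<in>M \<inter> T. a y = h y)" if "same_germ M x a h" for a h :: "'a \<Rightarrow> real"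
      using that unfolding same_germ_def openin_open by blast
    obtain T where T: "open T" "x \<in> T" "\<forall>y\<in>M \<inter> T. a y = u y"
      using germ[OF ab(3)] by auto
    obtain S where S: "open S" "x \<in> S" "\<forall>y\<in>M \<inter> S. b y = v y"
      using germ[OF ab(4)] by auto
    have "smooth_on (T \<inter> V) F" "smooth_on (S \<inter> W) G"
      using smooth_on_subset[OF V(3)] smooth_on_subset[OF W(3)] by auto
    then show ?thesis
      by (intro poisson_eq[OF ab(1,2), of "T \<inter> V" _ "S \<inter> W"]) (use T S V W in auto)
  qed
  show "\<exists>a b. smooth_fun M a \<and> smooth_fun M b \<and> same_germ M x a u \<and> same_germ M x b v \<and> ?s = br a b x"
  proof -
    obtain a b where ab: "smooth_fun M a" "same_germ M x a u" "smooth_fun M b" "same_germ M x b v"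
      using ext[OF V] ext[OF W] by auto
    show ?thesis using ab eq[OF ab(1,3,2,4)] by metis
  qed
  show "c = ?s" if "\<exists>a b. smooth_fun M a \<and> smooth_fun M b \<and> same_germ M x a u \<and> same_germ M x b v \<and> c = br a b x" for c
    using that eq by blast
qed

end

subsection \<open>Conjugate coordinates\<close>

locale surface_chart =
  fixes M U :: "'a::euclidean_space set" and p q :: "'a \<Rightarrow> real" and x :: 'a
  assumes coords: "local_coordinates M U p q" and x: "x \<in> U"
begin

definition \<Omega> :: "(real \<times> real) set" where "\<Omega> = (\<lambda>x. (p x, q x)) ` U"

definition \<Phi> :: "real \<times> real \<Rightarrow> 'a" where "\<Phi> = the_inv_into U (\<lambda>x. (p x, q x))"

text \<open>The differential of the inverse chart: \<open>L (1, 0)\<close> and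
  \<open>L (0, 1)\<close> are the vectors \<open>e\<close> and \<open>f\<close>.\<close>

definition L :: "real \<times> real \<Rightarrow> 'a" where "L = frechet_derivative \<Phi> (at (p x, q x))"

text \<open>\<open>d u (1, 0)\<close> and \<open>d u (0, 1)\<close> are the partial derivatives of \<open>u\<close> with respect to \<open>p\<close> and \<open>q\<close>
  at \<open>x\<close>.\<close>

definition d :: "('a \<Rightarrow> real) \<Rightarrow> real \<times> real \<Rightarrow> real" where
  "d u = frechet_derivative (\<lambda>z. u (\<Phi> z)) (at (p x, q x))"

definition local_extension :: "('a \<Rightarrow> real) \<Rightarrow> 'a set \<Rightarrow> ('a \<Rightarrow> real) \<Rightarrow> bool" where
  "local_extension u V F \<longleftrightarrow> open V \<and> x \<in> V \<and> smooth_on V F \<and> (\<forall>y\<in>M \<inter> V. u y = F y)"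

lemma U_openin: "openin (top_of_set M) U"
  and smooth_p: "smooth_fun U p" and smooth_q: "smooth_fun U q"
  and inj: "inj_on (\<lambda>x. (p x, q x)) U" and open_\<Omega>: "open \<Omega>" and smooth_\<Phi>: "smooth_on \<Omega> \<Phi>"
  using coords unfolding local_coordinates_def \<Omega>_def \<Phi>_def by auto

lemma x_M: "x \<in> M"
  using x U_openin openin_imp_subset by blast

lemma w_\<Omega>: "(p x, q x) \<in> \<Omega>"
  using x by (auto simp: \<Omega>_def)

lemma \<Phi>_coords: "y \<in> U \<Longrightarrow> \<Phi> (p y, q y) = y"
  unfolding \<Phi>_def using the_inv_into_f_f[OF inj] by simp

lemma \<Phi>_in_U: "z \<in> \<Omega> \<Longrightarrow> \<Phi> z \<in> U"
  unfolding \<Omega>_def using \<Phi>_coords by auto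

lemma coords_\<Phi>: "z \<in> \<Omega> \<Longrightarrow> (p (\<Phi> z), q (\<Phi> z)) = z"
  unfolding \<Omega>_def using \<Phi>_coords by auto

lemma \<Phi>_in_M: "z \<in> \<Omega> \<Longrightarrow> \<Phi> z \<in> M"
  using \<Phi>_in_U U_openin openin_imp_subset by blast

lemma \<Phi>_has_derivative: "(\<Phi> has_derivative L) (at (p x, q x))"
  unfolding L_def by (rule smooth_on_has_derivative[OF smooth_\<Phi> w_\<Omega>])

lemma linear_L: "linear L"
  by (rule has_derivative_linear[OF \<Phi>_has_derivative])

text \<open>Agreement is wanted on all of \<open>M\<close> inside the neighbourhood, not just on
  \<open>U\<close>; intersecting with an ambient open set that cuts \<open>U\<close> out of
  \<open>M\<close> achieves this.\<close>

lemma local_extension_exists: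
  assumes "smooth_fun U u"
  obtains V F where "local_extension u V F"
proof -
  obtain V F where V: "open V" "x \<in> V" "smooth_on V F" "\<forall>y\<in>U \<inter> V. u y = F y"
    using assms x unfolding smooth_fun_def by blast
  obtain T where T: "open T" "U = M \<inter> T" using U_openin by (auto simp: openin_open)
  have "local_extension u (V \<inter> T) F"
    unfolding local_extension_def using V T x smooth_on_subset[OF V(3)] by auto
  then show thesis by (rule that)
qed

lemma open_\<Phi>_vimage: "open V \<Longrightarrow> open (\<Omega> \<inter> \<Phi> -` V)"
  using continuous_open_preimage[OF smooth_on_imp_continuous_on[OF smooth_\<Phi>] open_\<Omega>] by blast

text \<open>\<open>\<Phi>\<close> takes values in \<open>M\<close>, so \<open>u\<close> and
  \<open>F\<close> agree after composition with \<open>\<Phi>\<close> near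
  \<open>(p x, q x)\<close>. The coordinate derivatives of \<open>u\<close> are therefore ambient
  derivatives along tangent vectors, whatever the extension.\<close>

lemma d_eq:
  assumes "local_extension u V F"
  shows "((\<lambda>z. u (\<Phi> z)) has_derivative (\<lambda>c. frechet_derivative F (at x) (L c))) (at (p x, q x))"
    and "d u c = frechet_derivative F (at x) (L c)"
proof -
  have V: "open V" "x \<in> V" "smooth_on V F" "\<forall>y\<in>M \<inter> V. u y = F y"
    using assms unfolding local_extension_def by auto
  have "(F has_derivative frechet_derivative F (at x)) (at (\<Phi> (p x, q x)))"
    using smooth_on_has_derivative[OF V(3,2)] \<Phi>_coords[OF x] by simp
  from has_derivative_compose[OF \<Phi>_has_derivative this]
  have "((\<lambda>z. F (\<Phi> z)) has_derivative (\<lambda>c. frechet_derivative F (at x) (L c))) (at (p x, q x))" .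
  then show der: "((\<lambda>z. u (\<Phi> z)) has_derivative (\<lambda>c. frechet_derivative F (at x) (L c))) (at (p x, q x))"
    by (rule has_derivative_transform_within_open[OF _ open_\<Phi>_vimage[OF V(1)]])
      (use w_\<Omega> \<Phi>_coords[OF x] V(2,4) \<Phi>_in_M in auto)
  show "d u c = frechet_derivative F (at x) (L c)"
    unfolding d_def using fun_cong[OF frechet_derivative_at[OF der], of c] by simp
qed

lemma d_p: "d p c = fst c" and d_q: "d q c = snd c"
proof -
  have p: "((\<lambda>z. p (\<Phi> z)) has_derivative fst) (at (p x, q x))"
    by (rule has_derivative_transform_within_open[OF _ open_\<Omega> w_\<Omega>])
      (use coords_\<Phi> in \<open>auto intro!: derivative_eq_intros simp: prod_eq_iff\<close>)
  have q: "((\<lambda>z. q (\<Phi> z)) has_derivative snd) (at (p x, q x))"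
    by (rule has_derivative_transform_within_open[OF _ open_\<Omega> w_\<Omega>])
      (use coords_\<Phi> in \<open>auto intro!: derivative_eq_intros simp: prod_eq_iff\<close>)
  show "d p c = fst c" "d q c = snd c"
    unfolding d_def using frechet_derivative_at[OF p] frechet_derivative_at[OF q] by metis+
qed

lemma linear_d:
  assumes "smooth_fun U u"
  shows "linear (d u)"
proof -
  obtain V F where "local_extension u V F" using local_extension_exists[OF assms] .
  from d_eq(1)[OF this] show ?thesis
    unfolding d_def using has_derivative_linear frechet_derivative_at by metis
qed

lemma d_pair: "smooth_fun U u \<Longrightarrow> d u (a, b) = a * d u (1, 0) + b * d u (0, 1)"
  using linear_add[OF linear_d, of u "a *\<^sub>R (1, 0)" "b *\<^sub>R (0, 1)"]
    linear_scale[OF linear_d, of u a "(1, 0)"] linear_scale[OF linear_d, of u b "(0, 1)"] by simp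

lemma L_pair: "L (a, b) = a *\<^sub>R L (1, 0) + b *\<^sub>R L (0, 1)"
  using linear_add[OF linear_L, of "a *\<^sub>R (1, 0)" "b *\<^sub>R (0, 1)"]
    linear_scale[OF linear_L, of a "(1, 0)"] linear_scale[OF linear_L, of b "(0, 1)"] by simp

text \<open>The ambient derivatives of extensions of \<open>p\<close> and \<open>q\<close> recover
  the two components of \<open>c\<close> from \<open>L c\<close>.\<close>

lemma L_eq_0: "L c = 0 \<Longrightarrow> c = 0"
proof -
  assume L: "L c = 0"
  obtain V P W Q where P: "local_extension p V P" and Q: "local_extension q W Q"
    using local_extension_exists smooth_p smooth_q by metis
  have "linear (frechet_derivative P (at x))" "linear (frechet_derivative Q (at x))"
    using P Q smooth_on_linear_derivative unfolding local_extension_def by blast+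
  then show "c = 0"
    using d_eq(2)[OF P, of c] d_eq(2)[OF Q, of c] L d_p[of c] d_q[of c]
    by (simp add: linear_0 prod_eq_iff)
qed

text \<open>Near \<open>x\<close>, \<open>u\<close> is also extended by \<open>(u \<circ> \<Phi>) \<circ> (P, Q)\<close>, where \<open>P\<close>, \<open>Q\<close> extend \<open>p\<close>, \<open>q\<close>. For this
  extension the chain rule expresses the derivative in terms of those of \<open>P\<close> and \<open>Q\<close>.\<close>

lemma coordinate_extension:
  assumes P: "local_extension p VP P" and Q: "local_extension q VQ Q" and u: "smooth_fun U u"
  obtains V F where "local_extension u V F"
    "\<And>b. frechet_derivative F (at x) b =
      d u (1, 0) * frechet_derivative P (at x) b + d u (0, 1) * frechet_derivative Q (at x) b"
proof -
  obtain V F where F: "local_extension u V F" using local_extension_exists[OF u] .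
  have VF: "open V" "x \<in> V" "smooth_on V F" "\<forall>y\<in>M \<inter> V. u y = F y"
    and VP: "open VP" "x \<in> VP" "smooth_on VP P" "\<forall>y\<in>M \<inter> VP. p y = P y"
    and VQ: "open VQ" "x \<in> VQ" "smooth_on VQ Q" "\<forall>y\<in>M \<inter> VQ. q y = Q y"
    using F P Q unfolding local_extension_def by auto
  obtain T where T: "open T" "U = M \<inter> T" using U_openin by (auto simp: openin_open)
  define S where "S = \<Omega> \<inter> \<Phi> -` V"
  \<comment> \<open>The preimage of \<open>S\<close> makes \<open>F (\<Phi> (P y, Q y))\<close>
    defined and smooth; \<open>T\<close> forces points of \<open>M\<close> in \<open>W\<close> into
    \<open>U\<close>, where \<open>\<Phi>\<close> inverts the coordinates.\<close>
  define W where "W = (VP \<inter> VQ \<inter> (\<lambda>y. (P y, Q y)) -` S) \<inter> T"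
  have oS: "open S" unfolding S_def by (rule open_\<Phi>_vimage[OF VF(1)])
  have sPQ: "smooth_on (VP \<inter> VQ) (\<lambda>y. (P y, Q y))"
    by (rule smooth_onI, rule Ck_on_Pair)
      (use VP(1) VQ(1) smooth_onD[OF smooth_on_subset[OF VP(3)]] smooth_onD[OF smooth_on_subset[OF VQ(3)]] in auto)
  have oW: "open W" unfolding W_def
    by (intro open_Int T continuous_open_preimage[OF smooth_on_imp_continuous_on[OF sPQ]] oS VP VQ)
  have PQx: "P x = p x" "Q x = q x" using VP(2,4) VQ(2,4) x_M by auto
  have xW: "x \<in> W" unfolding W_def S_def
    using VP(2) VQ(2) VF(2) PQx w_\<Omega> \<Phi>_coords[OF x] x T by auto
  have sF\<Phi>: "smooth_on S (\<lambda>z. F (\<Phi> z))"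
    by (rule smooth_on_compose[OF oS VF(1) _ smooth_on_subset[OF smooth_\<Phi>] VF(3)]) (auto simp: S_def)
  let ?F = "\<lambda>y. F (\<Phi> (P y, Q y))"
  have "smooth_on W ?F"
    by (rule smooth_on_compose[OF oW oS _ smooth_on_subset[OF sPQ] sF\<Phi>]) (auto simp: W_def)
  moreover have "u y = ?F y" if "y \<in> M \<inter> W" for y
  proof -
    have "y \<in> U" "P y = p y" "Q y = q y" using that T VP(4) VQ(4) by (auto simp: W_def)
    then have "\<Phi> (P y, Q y) = y" using \<Phi>_coords by simp
    then show ?thesis using that VF(4) by (auto simp: W_def S_def)
  qed
  ultimately have ext: "local_extension u W ?F" unfolding local_extension_def using oW xW by auto
  have D1: "((\<lambda>z. F (\<Phi> z)) has_derivative d u) (at (P x, Q x))"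
  proof -
    have "d u = (\<lambda>c. frechet_derivative F (at x) (L c))" using d_eq(2)[OF F] by auto
    moreover have "((\<lambda>z. F (\<Phi> z)) has_derivative (\<lambda>c. frechet_derivative F (at x) (L c))) (at (p x, q x))"
      by (rule has_derivative_transform_within_open[OF d_eq(1)[OF F] oS])
        (use w_\<Omega> \<Phi>_coords[OF x] VF(2,4) \<Phi>_in_M in \<open>auto simp: S_def\<close>)
    ultimately show ?thesis using PQx by simp
  qed
  have D2: "((\<lambda>y. (P y, Q y)) has_derivative
      (\<lambda>b. (frechet_derivative P (at x) b, frechet_derivative Q (at x) b))) (at x)"
    by (intro has_derivative_Pair smooth_on_has_derivative[OF VP(3,2)] smooth_on_has_derivative[OF VQ(3,2)])
  have D: "(?F has_derivative (\<lambda>b. d u (frechet_derivative P (at x) b, frechet_derivative Q (at x) b))) (at x)"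
    using has_derivative_compose[OF D2 D1] .
  show thesis
  proof (rule that[OF ext])
    fix b
    show "frechet_derivative ?F (at x) b =
      d u (1, 0) * frechet_derivative P (at x) b + d u (0, 1) * frechet_derivative Q (at x) b"
      using frechet_derivative_at[OF D] d_pair[OF u] by (metis mult.commute)
  qed
qed

text \<open>The bracket is an antisymmetric bilinear form \<open>\<Theta>\<close> in the ambient
  derivatives. With extensions that factor through \<open>P\<close> and \<open>Q\<close>, both
  arguments lie in the span of the derivatives of \<open>P\<close> and \<open>Q\<close>, on which
  \<open>\<Theta>\<close> is fixed by its value \<open>1\<close> on this pair.\<close>

lemma local_bracket_conjugate:
  assumes br: "poisson_structure M br" and pq: "local_bracket M br p q x = 1"
    and u: "smooth_fun U u" and v: "smooth_fun U v"
  shows "local_bracket M br u v x = d u (1, 0) * d v (0, 1) - d u (0, 1) * d v (1, 0)"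
proof -
  define \<Theta> where "\<Theta> = (\<lambda>f g. \<Sum>i\<in>Basis. \<Sum>j\<in>Basis. f i * g j * br (\<lambda>y. y \<bullet> i) (\<lambda>y. y \<bullet> j) x)"
  have loc: "local_bracket M br f g x = \<Theta> (frechet_derivative F (at x)) (frechet_derivative G (at x))"
    if "local_extension f V F" "local_extension g W G" for f g V F W G
    using that local_bracket_eq[OF br x_M] unfolding local_extension_def \<Theta>_def by blast
  have coord: "smooth_fun M (\<lambda>y. y \<bullet> b)" for b :: 'a by (intro smooth_fun_linear bounded_linear_inner_left)
  have antisym: "\<Theta> f g = - \<Theta> g f" for f g :: "'a \<Rightarrow> real"
  proof -
    have "\<Theta> f g = (\<Sum>j\<in>Basis. \<Sum>i\<in>Basis. f i * g j * br (\<lambda>y. y \<bullet> i) (\<lambda>y. y \<bullet> j) x)"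
      unfolding \<Theta>_def by (rule sum.swap)
    also have "\<dots> = - \<Theta> g f"
      unfolding \<Theta>_def sum_negf[symmetric]
      by (intro sum.cong refl) (simp add: poisson_antisym[OF br x_M coord coord, symmetric] mult_ac flip: mult_minus_right)
    finally show ?thesis .
  qed
  have left: "\<Theta> (\<lambda>b. a * f b + a' * f' b) g = a * \<Theta> f g + a' * \<Theta> f' g"
    for a a' and f f' g :: "'a \<Rightarrow> real"
    unfolding \<Theta>_def sum_distrib_left sum.distrib[symmetric] by (simp add: algebra_simps)
  have right: "\<Theta> g (\<lambda>b. a * f b + a' * f' b) = a * \<Theta> g f + a' * \<Theta> g f'"
    for a a' and f f' g :: "'a \<Rightarrow> real"
    unfolding \<Theta>_def sum_distrib_left sum.distrib[symmetric] by (simp add: algebra_simps)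
  obtain VP P VQ Q where P: "local_extension p VP P" and Q: "local_extension q VQ Q"
    using local_extension_exists smooth_p smooth_q by metis
  let ?P = "frechet_derivative P (at x)" and ?Q = "frechet_derivative Q (at x)"
  obtain V F where F: "local_extension u V F"
    "\<And>b. frechet_derivative F (at x) b = d u (1, 0) * ?P b + d u (0, 1) * ?Q b"
    using coordinate_extension[OF P Q u] by blast
  obtain W G where G: "local_extension v W G"
    "\<And>b. frechet_derivative G (at x) b = d v (1, 0) * ?P b + d v (0, 1) * ?Q b"
    using coordinate_extension[OF P Q v] by blast
  have "frechet_derivative F (at x) = (\<lambda>b. d u (1, 0) * ?P b + d u (0, 1) * ?Q b)"
    "frechet_derivative G (at x) = (\<lambda>b. d v (1, 0) * ?P b + d v (0, 1) * ?Q b)"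
    using F(2) G(2) by auto
  moreover have "\<Theta> ?P ?Q = 1" using loc[OF P Q] pq by simp
  moreover have "\<Theta> ?Q ?P = - 1" using antisym[of ?Q ?P] calculation by simp
  moreover have "\<Theta> ?P ?P = 0" "\<Theta> ?Q ?Q = 0" using antisym[of ?P ?P] antisym[of ?Q ?Q] by auto
  ultimately show ?thesis
    unfolding loc[OF F(1) G(1)] by (simp only: left right) (simp add: algebra_simps)
qed

subsection \<open>The tangent plane\<close>

text \<open>A curve in \<open>M\<close> sees no difference between \<open>u\<close> and
  \<open>F\<close>, so the derivative along it depends only on the velocity. This is the uniqueness
  behind \<open>differential\<close>.\<close>

lemma curve_differential:
  assumes "curve_at M x \<gamma>" and u: "local_extension u V F"
  shows "((\<lambda>t. u (\<gamma> t)) has_real_derivative frechet_derivative F (at x) (vector_derivative \<gamma> (at 0))) (at 0)"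
proof -
  obtain e where e: "e > 0" "smooth_on {-e<..<e} \<gamma>" "\<gamma> ` {-e<..<e} \<subseteq> M" "\<gamma> 0 = x"
    using assms(1) unfolding curve_at_def by blast
  have V: "open V" "x \<in> V" "smooth_on V F" "\<forall>y\<in>M \<inter> V. u y = F y"
    using u unfolding local_extension_def by auto
  have "\<gamma> differentiable (at 0)"
    using smooth_on_has_derivative[OF e(2), of 0] e(1) unfolding differentiable_def by auto
  then have g: "(\<gamma> has_derivative (\<lambda>s. s *\<^sub>R vector_derivative \<gamma> (at 0))) (at 0)"
    using vector_derivative_works has_vector_derivative_def by blast
  have "(F has_derivative frechet_derivative F (at x)) (at (\<gamma> 0))"
    using smooth_on_has_derivative[OF V(3,2)] e(4) by simp
  from has_derivative_compose[OF g this]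
  have "((\<lambda>t. F (\<gamma> t)) has_derivative
      (\<lambda>s. frechet_derivative F (at x) (s *\<^sub>R vector_derivative \<gamma> (at 0)))) (at 0)" .
  moreover have "(\<lambda>s. frechet_derivative F (at x) (s *\<^sub>R vector_derivative \<gamma> (at 0)))
      = (*) (frechet_derivative F (at x) (vector_derivative \<gamma> (at 0)))"
    by (auto simp: linear_scale[OF smooth_on_linear_derivative[OF V(3,2)]])
  ultimately have "((\<lambda>t. F (\<gamma> t)) has_derivative
      (*) (frechet_derivative F (at x) (vector_derivative \<gamma> (at 0)))) (at 0)" by simp
  moreover have "open ({-e<..<e} \<inter> \<gamma> -` V)"
    by (rule continuous_open_preimage[OF smooth_on_imp_continuous_on[OF e(2)] _ V(1)]) simp
  ultimately have "((\<lambda>t. u (\<gamma> t)) has_derivative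
      (*) (frechet_derivative F (at x) (vector_derivative \<gamma> (at 0)))) (at 0)"
  proof (rule has_derivative_transform_within_open)
    show "0 \<in> {-e<..<e} \<inter> \<gamma> -` V" using e(1,4) V(2) by simp
    fix t assume "t \<in> {-e<..<e} \<inter> \<gamma> -` V"
    then have "\<gamma> t \<in> M \<inter> V" using e(3) by blast
    then show "F (\<gamma> t) = u (\<gamma> t)" using V(4) by simp
  qed
  then show ?thesis unfolding has_field_derivative_def .
qed

lemma L_in_tangent_space: "L c \<in> tangent_space M x"
proof -
  let ?w = "(p x, q x)"
  obtain r where r: "r > 0" "ball ?w r \<subseteq> \<Omega>" using open_\<Omega> w_\<Omega> open_contains_ball by blast
  \<comment> \<open>The summand \<open>1\<close> covers \<open>c = 0\<close>; the segment then stays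
    in the ball on which \<open>\<Phi>\<close> is smooth.\<close>
  define e where "e = r / (norm c + 1)"
  have e: "e > 0" using r by (simp add: e_def add_nonneg_pos)
  define \<gamma> where "\<gamma> = (\<lambda>t. \<Phi> (?w + t *\<^sub>R c))"
  have inball: "?w + t *\<^sub>R c \<in> ball ?w r" if "t \<in> {-e<..<e}" for t
  proof -
    have "\<bar>t\<bar> * norm c \<le> \<bar>t\<bar> * (norm c + 1)" by (simp add: mult_left_mono)
    also have "\<dots> < e * (norm c + 1)" using that by (intro mult_strict_right_mono) (auto simp: add_nonneg_pos)
    also have "\<dots> = r" unfolding e_def using add_nonneg_pos[of "norm c" 1] by simp
    finally have "norm (t *\<^sub>R c) < r" by simp
    then show ?thesis by (simp only: mem_ball dist_norm) (simp add: norm_minus_commute)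
  qed
  have line: "smooth_on {-e<..<e} (\<lambda>t. ?w + t *\<^sub>R c)"
    by (intro smooth_on_add smooth_on_const smooth_on_linear bounded_linear_scaleR_left open_greaterThanLessThan)
  have "smooth_on {-e<..<e} \<gamma>" unfolding \<gamma>_def
    by (rule smooth_on_compose[OF _ open_\<Omega> _ line smooth_\<Phi>]) (use inball r(2) in auto)
  moreover have "\<gamma> ` {-e<..<e} \<subseteq> M" using inball r(2) \<Phi>_in_M unfolding \<gamma>_def by blast
  moreover have "\<gamma> 0 = x" unfolding \<gamma>_def using \<Phi>_coords[OF x] by simp
  ultimately have "curve_at M x \<gamma>" unfolding curve_at_def using e by blast
  moreover have "(\<gamma> has_vector_derivative L c) (at 0)"
  proof -
    have 1: "((\<lambda>t. ?w + t *\<^sub>R c) has_derivative (\<lambda>t. t *\<^sub>R c)) (at 0)"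
      by (auto intro!: derivative_eq_intros)
    have 2: "(\<Phi> has_derivative L) (at (?w + 0 *\<^sub>R c))" using \<Phi>_has_derivative by simp
    have "(\<gamma> has_derivative (\<lambda>t. L (t *\<^sub>R c))) (at 0)"
      unfolding \<gamma>_def using has_derivative_compose[OF 1 2] .
    then show ?thesis unfolding has_vector_derivative_def by (simp only: linear_scale[OF linear_L])
  qed
  then have "vector_derivative \<gamma> (at 0) = L c" by (rule vector_derivative_at)
  ultimately show ?thesis unfolding tangent_space_def by (intro CollectI exI[of _ \<gamma>]) simp
qed

text \<open>A curve in \<open>M\<close> through \<open>x\<close> stays in \<open>U\<close> for small
  times because \<open>U\<close> is open in \<open>M\<close>. There it equals \<open>\<Phi>\<close>
  applied to its coordinates, and the chain rule puts its velocity in the range of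
  \<open>L\<close>.\<close>

lemma tangent_space_eq: "tangent_space M x = range L"
proof
  show "range L \<subseteq> tangent_space M x" using L_in_tangent_space by blast
  show "tangent_space M x \<subseteq> range L"
  proof
    fix X assume "X \<in> tangent_space M x"
    then obtain \<gamma> where g: "curve_at M x \<gamma>" and X: "X = vector_derivative \<gamma> (at 0)"
      unfolding tangent_space_def by blast
    obtain VP P VQ Q where P: "local_extension p VP P" and Q: "local_extension q VQ Q"
      using local_extension_exists smooth_p smooth_q by metis
    obtain e where e: "e > 0" "smooth_on {-e<..<e} \<gamma>" "\<gamma> ` {-e<..<e} \<subseteq> M" "\<gamma> 0 = x"
      using g unfolding curve_at_def by blast
    obtain T where T: "open T" "U = M \<inter> T" using U_openin by (auto simp: openin_open)
    define c where "c = (frechet_derivative P (at x) X, frechet_derivative Q (at x) X)"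
    have "((\<lambda>t. (p (\<gamma> t), q (\<gamma> t))) has_vector_derivative c) (at 0)"
      using has_vector_derivative_Pair[OF curve_differential[OF g P, unfolded has_real_derivative_iff_has_vector_derivative]
        curve_differential[OF g Q, unfolded has_real_derivative_iff_has_vector_derivative]]
      unfolding c_def X .
    then have 1: "((\<lambda>t. (p (\<gamma> t), q (\<gamma> t))) has_derivative (\<lambda>t. t *\<^sub>R c)) (at 0)"
      unfolding has_vector_derivative_def .
    have 2: "(\<Phi> has_derivative L) (at (p (\<gamma> 0), q (\<gamma> 0)))" using \<Phi>_has_derivative e(4) by simp
    have "((\<lambda>t. \<Phi> (p (\<gamma> t), q (\<gamma> t))) has_derivative (\<lambda>t. L (t *\<^sub>R c))) (at 0)"
      using has_derivative_compose[OF 1 2] .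
    moreover have "open ({-e<..<e} \<inter> \<gamma> -` T)"
      by (rule continuous_open_preimage[OF smooth_on_imp_continuous_on[OF e(2)] _ T(1)]) simp
    ultimately have "(\<gamma> has_derivative (\<lambda>t. L (t *\<^sub>R c))) (at 0)"
    proof (rule has_derivative_transform_within_open)
      show "0 \<in> {-e<..<e} \<inter> \<gamma> -` T" using e T x by auto
      fix t assume "t \<in> {-e<..<e} \<inter> \<gamma> -` T"
      then have "\<gamma> t \<in> U" using e(3) T(2) by auto
      then show "\<Phi> (p (\<gamma> t), q (\<gamma> t)) = \<gamma> t" by (rule \<Phi>_coords)
    qed
    then have "(\<gamma> has_vector_derivative L c) (at 0)"
      unfolding has_vector_derivative_def by (simp only: linear_scale[OF linear_L])
    then show "X \<in> range L" unfolding X using vector_derivative_at by blast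
  qed
qed

lemma differential_eq:
  assumes "smooth_fun U u"
  shows "differential M u x (L c) = d u c"
proof -
  obtain V F where F: "local_extension u V F" using local_extension_exists[OF assms] .
  obtain \<gamma> where g: "curve_at M x \<gamma>" "L c = vector_derivative \<gamma> (at 0)"
    using L_in_tangent_space[of c] unfolding tangent_space_def by blast
  show ?thesis
    unfolding differential_def
  proof (rule the_equality)
    show "\<exists>\<gamma>. curve_at M x \<gamma> \<and> vector_derivative \<gamma> (at 0) = L c \<and>
        ((\<lambda>t. u (\<gamma> t)) has_real_derivative d u c) (at 0)"
      using g curve_differential[OF g(1) F] d_eq(2)[OF F, of c] by auto
    fix a assume "\<exists>\<gamma>. curve_at M x \<gamma> \<and> vector_derivative \<gamma> (at 0) = L c \<and>
        ((\<lambda>t. u (\<gamma> t)) has_real_derivative a) (at 0)"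
    then obtain \<delta> where h: "curve_at M x \<delta>" "vector_derivative \<delta> (at 0) = L c"
        "((\<lambda>t. u (\<delta> t)) has_real_derivative a) (at 0)" by blast
    show "a = d u c"
      using DERIV_unique[OF h(3) curve_differential[OF h(1) F]] h(2) d_eq(2)[OF F, of c] by simp
  qed
qed

section \<open>Gram determinant and metric dual\<close>

definition \<Delta> :: real where
  "\<Delta> = (L (1, 0) \<bullet> L (1, 0)) * (L (0, 1) \<bullet> L (0, 1)) - (L (1, 0) \<bullet> L (0, 1))\<^sup>2"

text \<open>With \<open>e\<close> and \<open>f\<close> for the two columns of \<open>L\<close>, the
  vector \<open>(f \<bullet> f) e - (e \<bullet> f) f\<close> is a multiple of the part of
  \<open>e\<close> orthogonal to \<open>f\<close>, and its squared norm is
  \<open>(f \<bullet> f) * \<Delta>\<close>. If \<open>\<Delta>\<close> vanished, injectivity of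
  \<open>L\<close> would force \<open>f = 0\<close>.\<close>

lemma \<Delta>_nonzero: "\<Delta> \<noteq> 0"
proof
  assume 0: "\<Delta> = 0"
  let ?e = "L (1, 0)" and ?f = "L (0, 1)"
  have "L (?f \<bullet> ?f, - (?e \<bullet> ?f)) \<bullet> L (?f \<bullet> ?f, - (?e \<bullet> ?f)) = (?f \<bullet> ?f) * \<Delta>"
    unfolding L_pair[of "?f \<bullet> ?f"] \<Delta>_def
    by (simp add: inner_left_distrib inner_right_distrib inner_diff_left inner_diff_right
        inner_commute[of ?f ?e] power2_eq_square algebra_simps)
  then have "L (?f \<bullet> ?f, - (?e \<bullet> ?f)) = 0" using 0 by simp
  then have "?f = 0" using L_eq_0 by (metis inner_eq_zero_iff prod.inject zero_prod_def)
  then show False using L_eq_0[of "(0, 1)"] by (simp add: prod_eq_iff)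
qed

text \<open>Testing the defining equation on the two columns of \<open>L\<close> gives a linear
  system with the Gram matrix; the coefficients are its solution by Cramer's rule.\<close>

lemma sharp_eq:
  assumes u: "smooth_fun U u"
  shows "sharp M induced_metric x (differential M u x) =
    L (((L (0, 1) \<bullet> L (0, 1)) * d u (1, 0) - (L (1, 0) \<bullet> L (0, 1)) * d u (0, 1)) / \<Delta>,
       ((L (1, 0) \<bullet> L (1, 0)) * d u (0, 1) - (L (1, 0) \<bullet> L (0, 1)) * d u (1, 0)) / \<Delta>)"
    (is "_ = L ?c")
  unfolding sharp_def induced_metric_def
proof (rule the_equality)
  have eq: "L ?c \<bullet> L (a, b) = d u (a, b)" for a b
  proof -
    let ?e = "L (1, 0)" and ?f = "L (0, 1)"
    have "\<Delta> * (L ?c \<bullet> L (a, b)) = \<Delta> * d u (a, b)"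
      unfolding L_pair[of a b] L_pair[of "_ / \<Delta>"] d_pair[OF u, of a b] inner_add_left inner_add_right
        inner_scaleR_left inner_scaleR_right inner_commute[of ?f ?e]
      using \<Delta>_nonzero
      by (simp add: field_simps) (simp add: \<Delta>_def power2_eq_square algebra_simps)
    then show ?thesis using \<Delta>_nonzero by simp
  qed
  show "L ?c \<in> tangent_space M x \<and> (\<forall>X\<in>tangent_space M x. differential M u x X = L ?c \<bullet> X)"
    unfolding tangent_space_eq using eq by (auto simp: differential_eq[OF u])
  fix Y assume Y: "Y \<in> tangent_space M x \<and> (\<forall>X\<in>tangent_space M x. differential M u x X = Y \<bullet> X)"
  then obtain c where c: "Y = L c" unfolding tangent_space_eq by blast
  have "Y \<bullet> L (a, b) = L ?c \<bullet> L (a, b)" for a b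
    using Y eq[of a b] differential_eq[OF u, of "(a, b)"] unfolding tangent_space_eq by auto
  then have "Y \<bullet> L z = L ?c \<bullet> L z" for z by (cases z) simp
  then have "(Y - L ?c) \<bullet> L z = 0" for z by (simp add: inner_diff_left)
  \<comment> \<open>The difference of two solutions is itself tangent, hence orthogonal to
    itself.\<close>
  moreover have "Y - L ?c = L (c - ?c)" unfolding c by (rule linear_diff[OF linear_L, symmetric])
  ultimately have "(Y - L ?c) \<bullet> (Y - L ?c) = 0" by metis
  then show "Y = L ?c" by simp
qed

lemma metric_sharp_eq:
  assumes u: "smooth_fun U u" and v: "smooth_fun U v"
  shows "sharp M induced_metric x (differential M u x) \<bullet> sharp M induced_metric x (differential M v x) =
    1 / \<Delta> * ((L (1, 0) \<bullet> L (1, 0)) * d u (0, 1) * d v (0, 1)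
      - (L (1, 0) \<bullet> L (0, 1)) * (d u (1, 0) * d v (0, 1) + d u (0, 1) * d v (1, 0))
      + (L (0, 1) \<bullet> L (0, 1)) * d u (1, 0) * d v (1, 0))" (is "?l = 1 / \<Delta> * ?r")
proof -
  let ?e = "L (1, 0)" and ?f = "L (0, 1)"
  \<comment> \<open>Each dual vector carries a denominator \<open>\<Delta>\<close>. Clearing both
    leaves one factor \<open>\<Delta>\<close> on the right, since the cofactor matrix times the Gram
    matrix is \<open>\<Delta>\<close> times the identity.\<close>
  have "\<Delta> * (\<Delta> * ?l) = \<Delta> * ?r"
    unfolding sharp_eq[OF u] sharp_eq[OF v] L_pair[of "_ / \<Delta>"] inner_add_left inner_add_right
      inner_scaleR_left inner_scaleR_right inner_commute[of ?f ?e]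
    using \<Delta>_nonzero
    by (simp add: field_simps) (simp add: \<Delta>_def power2_eq_square algebra_simps)
  then have "\<Delta> * ?l = ?r" by (rule mult_left_cancel[OF \<Delta>_nonzero, THEN iffD1])
  then have "?l = ?r / \<Delta>" by (simp only: nonzero_eq_divide_eq[OF \<Delta>_nonzero] mult.commute)
  then show ?thesis by simp
qed

lemma d_linear:
  assumes "bounded_linear f"
  shows "d f c = f (L c)"
proof -
  have "local_extension f UNIV f"
    unfolding local_extension_def using smooth_on_linear[OF open_UNIV assms] by simp
  then show ?thesis
    using d_eq(2) frechet_derivative_at[OF bounded_linear_imp_has_derivative[OF assms]] by metis
qed

end

section \<open>The metric recovered from Poisson brackets\<close>

theorem theorem18:
  fixes M U :: "(real ^ 'n) set"
    and br :: "(real ^ 'n \<Rightarrow> real) \<Rightarrow> (real ^ 'n \<Rightarrow> real) \<Rightarrow> real ^ 'n \<Rightarrow> real"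
    and p q u v :: "real ^ 'n \<Rightarrow> real"
    and coord :: "'n \<Rightarrow> real ^ 'n \<Rightarrow> real"
    and pb :: "(real ^ 'n \<Rightarrow> real) \<Rightarrow> (real ^ 'n \<Rightarrow> real) \<Rightarrow> real ^ 'n \<Rightarrow> real"
    and C :: "real ^ 'n \<Rightarrow> real"
  defines "coord \<equiv> \<lambda>i y. y $ i"
    and "pb \<equiv> local_bracket M br"
    and "C \<equiv> \<lambda>x. \<Sum>i\<in>UNIV. \<Sum>j\<in>UNIV. pb p (coord i) x * pb q (coord j) x * pb (coord i) (coord j) x"
  assumes "embedded_surface M"
    and "poisson_structure M br"
    and "conjugate_coordinates M br U p q"
    and "smooth_fun U u" and "smooth_fun U v"
  shows "\<forall>x\<in>U. C x \<noteq> 0 \<and>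
           induced_metric x (sharp M induced_metric x (differential M u x))
                            (sharp M induced_metric x (differential M v x))
           = 1 / C x * (\<Sum>i\<in>UNIV. pb (coord i) u x * pb (coord i) v x)"
proof
  fix x assume x: "x \<in> U"
  interpret surface_chart M U p q x
    by unfold_locales (use assms x in \<open>auto simp: conjugate_coordinates_def\<close>)
  have pq: "local_bracket M br p q x = 1" using assms x by (simp add: conjugate_coordinates_def)
  note bracket = local_bracket_conjugate[OF \<open>poisson_structure M br\<close> pq]
  have bl: "bounded_linear (coord i)" for i unfolding coord_def by (rule bounded_linear_vec_nth)
  have sc: "smooth_fun U (coord i)" for i by (rule smooth_fun_linear[OF bl])
  let ?e = "L (1, 0)" and ?f = "L (0, 1)"
  have dc: "d (coord i) c = L c $ i" for i c by (simp add: d_linear[OF bl]) (simp add: coord_def)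
  have pbc: "pb (coord i) h x = ?e $ i * d h (0, 1) - ?f $ i * d h (1, 0)" if "smooth_fun U h" for i h
    unfolding pb_def bracket[OF sc that] dc ..
  \<comment> \<open>\<open>p\<close> and \<open>q\<close> have partial derivatives
    \<open>(1, 0)\<close> and \<open>(0, 1)\<close>, so bracketing with them differentiates along
    \<open>q\<close> and, with a minus sign, along \<open>p\<close>.\<close>
  have pbp: "pb p (coord i) x = ?f $ i" and pbq: "pb q (coord i) x = - (?e $ i)" for i
    unfolding pb_def bracket[OF smooth_p sc] bracket[OF smooth_q sc] dc d_p d_q by simp_all
  have inner: "a \<bullet> b = (\<Sum>i\<in>UNIV. a $ i * b $ i)" for a b :: "real ^ 'n" by (simp add: inner_vec_def)
  \<comment> \<open>The minus sign from \<open>q\<close> reverses the two terms of the bracket of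
    the embedding coordinates. Each term of the double sum then separates into a factor in
    \<open>i\<close> and one in \<open>j\<close>.\<close>
  have "C x = (\<Sum>i\<in>UNIV. \<Sum>j\<in>UNIV. (?e $ j * ?e $ j) * (?f $ i * ?f $ i) - (?e $ i * ?f $ i) * (?e $ j * ?f $ j))"
    unfolding C_def pbp pbq pbc[OF sc] dc by (intro sum.cong refl) (simp add: algebra_simps)
  also have "\<dots> = (?f \<bullet> ?f) * (?e \<bullet> ?e) - (?e \<bullet> ?f) * (?e \<bullet> ?f)"
    unfolding inner sum_product sum_subtractf by (simp add: mult_ac)
  finally have C: "C x = \<Delta>" by (simp add: \<Delta>_def power2_eq_square mult.commute)
  \<comment> \<open>The product of brackets expands into the quadratic form of the cofactors of the
    Gram matrix, the numerator in \<open>metric_sharp_eq\<close>.\<close>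
  have "(\<Sum>i\<in>UNIV. pb (coord i) u x * pb (coord i) v x) =
      (?e \<bullet> ?e) * d u (0, 1) * d v (0, 1)
      - (?e \<bullet> ?f) * (d u (1, 0) * d v (0, 1) + d u (0, 1) * d v (1, 0))
      + (?f \<bullet> ?f) * d u (1, 0) * d v (1, 0)"
    unfolding pbc[OF \<open>smooth_fun U u\<close>] pbc[OF \<open>smooth_fun U v\<close>] inner sum_distrib_right
      sum_subtractf[symmetric] sum.distrib[symmetric]
    by (intro sum.cong refl) (simp add: algebra_simps)
  then show "C x \<noteq> 0 \<and>
           induced_metric x (sharp M induced_metric x (differential M u x))
                            (sharp M induced_metric x (differential M v x))
           = 1 / C x * (\<Sum>i\<in>UNIV. pb (coord i) u x * pb (coord i) v x)"
    using metric_sharp_eq[OF \<open>smooth_fun U u\<close> \<open>smooth_fun U v\<close>] \<Delta>_nonzero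
    unfolding C by (simp add: induced_metric_def)
qed

end
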